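(* Let $N=pq$ where $p$ and $q$ are distinct primes greater than $3$. If $k$ is a positive integer satisfying $$\gcd\left(\frac{p-1}{2},\frac{q-1}{2},\frac{pq-1}{2},12\right)\Big|\,k,$$ then $M_k^!(\Gamma_1(N))$ contains an $\eta$-quotient of level $N$.
   Context: $\eta(z)=q^{1/24}\prod_{n\ge1}(1-q^n)$ with $q=e^{2\pi i z}$, for $z$ in the upper half plane $\mathcal H$. An $\eta$-quotient of level $N$ is a function $\prod_{\delta\mid N}\eta(\delta z)^{r_\delta}$ with all $r_\delta\in\mathbb Z$; its weight is $\frac12\sum_{\delta\mid N}r_\delta$. $\Gamma_1(N)$ is the group of matrices in $\mathrm{SL}_2(\mathbb Z)$ congruent to $\begin{pmatrix}1&*\\0&1\end{pmatrix}$ modulo $N$. $M_k^!(\Gamma_1(N))$ is the space of weakly modular functions of weight $k$ for $\Gamma_1(N)$: functions $f$ holomorphic on $\mathcal H$, satisfying $(cz+d)^{-k}f\left(\frac{az+b}{cz+d}\right)=f(z)$ for all $\begin{pmatrix}a&b\\c&d\end{pmatrix}\in\Gamma_1(N)$, and meromorphic at every cusp. *)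

theory Defs
  imports
    "HOL-Complex_Analysis.Complex_Analysis"
    "HOL-Number_Theory.Number_Theory"
begin

definition upper_half_plane :: "complex set" where
  "upper_half_plane = {z. Im z > 0}"

(* The infinite product starts at index 0, hence Suc n. *)
definition dedekind_eta :: "complex \<Rightarrow> complex" where
  "dedekind_eta z =
     exp (2 * of_real pi * \<i> * z / 24) *
     (\<Prod>n. 1 - exp (2 * of_real pi * \<i> * z) ^ Suc n)"

definition eta_quotient :: "nat \<Rightarrow> (nat \<Rightarrow> int) \<Rightarrow> complex \<Rightarrow> complex" where
  "eta_quotient N r z = (\<Prod>\<delta> | \<delta> dvd N. dedekind_eta (of_nat \<delta> * z) powi r \<delta>)"

definition SL2Z :: "(int ^ 2 ^ 2) set" where
  "SL2Z = {A. det A = 1}"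

definition Gamma1 :: "nat \<Rightarrow> (int ^ 2 ^ 2) set" where
  "Gamma1 N = {A \<in> SL2Z.
     [A $ 1 $ 1 = 1] (mod int N) \<and> [A $ 2 $ 1 = 0] (mod int N) \<and> [A $ 2 $ 2 = 1] (mod int N)}"

definition moebius :: "int ^ 2 ^ 2 \<Rightarrow> complex \<Rightarrow> complex" where
  "moebius A z =
     (of_int (A $ 1 $ 1) * z + of_int (A $ 1 $ 2)) / (of_int (A $ 2 $ 1) * z + of_int (A $ 2 $ 2))"

definition slash :: "int \<Rightarrow> (complex \<Rightarrow> complex) \<Rightarrow> int ^ 2 ^ 2 \<Rightarrow> complex \<Rightarrow> complex" where
  "slash k f A z = (of_int (A $ 2 $ 1) * z + of_int (A $ 2 $ 2)) powi (- k) * f (moebius A z)"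

(* Let f be invariant under the weight-k action of Gamma1 N. For A in SL2Z, the function
   slash k f A is then invariant under A^-1 (Gamma1 N) A, which contains the translation
   z |-> z + N. It is therefore a function g of exp (2 pi i z / N) on the punctured unit disc,
   and f is meromorphic at the cusp A(infinity) iff g is meromorphic at 0. Every cusp is
   A(infinity) for some A in SL2Z. The width of the cusp may be a proper divisor of N; using N
   for all cusps does not change the notion, and avoids a case distinction for irregular cusps
   in odd weight. The value g 0 is immaterial. *)
definition meromorphic_at_cusps :: "nat \<Rightarrow> int \<Rightarrow> (complex \<Rightarrow> complex) \<Rightarrow> bool" where
  "meromorphic_at_cusps N k f \<longleftrightarrow>
     (\<forall>A \<in> SL2Z. \<exists>g. g meromorphic_on {0} \<and>
        (\<forall>z \<in> upper_half_plane.
           slash k f A z = g (exp (2 * of_real pi * \<i> * z / of_nat N))))"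

(* The space of weakly modular functions of weight k for Gamma1 N. Its elements are functions
   on the upper half plane; their values elsewhere are unconstrained. *)
definition weakly_modular_Gamma1 :: "nat \<Rightarrow> int \<Rightarrow> (complex \<Rightarrow> complex) set" where
  "weakly_modular_Gamma1 N k = {f.
     f holomorphic_on upper_half_plane \<and>
     (\<forall>A \<in> Gamma1 N. \<forall>z \<in> upper_half_plane. slash k f A z = f z) \<and>
     meromorphic_at_cusps N k f}"

end

(* Idea: with e(x) = exp (2 pi i x), the Klein form k_(a1,a2)(z) built from the odd theta function is,
   up to a root of unity, invariant under translating (a1,a2) by integers and satisfies the exact law
   k_a(Az) = (cz+d)^-1 k_(aA)(z) on SL2(Z); by Liouville's theorem the latter follows from comparing
   quasi-periods. For a prime n = 2h+1 > 3, the product of k_(0,r/n) over 1 <= r <= h is a constant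
   times eta(nz) / eta(z)^n, and on Gamma1(n) the roots of unity cancel, so this eta-quotient has
   weight -h and trivial character. The fourth power of the product over the three half-periods is a
   constant times eta^-24, hence eta^24 has weight 12. With h = (p-1)/2 and h' = (q-1)/2, products of
   powers of these three functions realise every weight k divisible by gcd(h, h', 12); the entry
   (pq-1)/2 = 2hh' + h + h' does not change the gcd. At the cusps, the product expansion of the Klein
   forms is read off directly. *)
theory Submission imports Defs begin

section \<open>Infinite products\<close>

text \<open>The obstacle is the multiplier system of eta, whose roots of unity on a general matrix
  involve Dedekind sums. They are never computed. Since the derivative of the normalised theta
  function at the origin does not depend on the lattice, comparing derivatives at 0 fixes the factor
  in the transformation law completely, with no unknown root of unity left over. The roots of unity
  that remain all come from shifting characteristics by integers; they are explicit, and multiplying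
  them means adding exponents. For n = 2h+1 the sums that occur are those of r and of r^2 over 1 <=
  r <= h, namely h(h+1)/2 and h(h+1)n/6. This explains the restriction to primes above 3: it makes
  h(h+1) divisible by 6. For eta^24 the half-periods are the right points because SL2(Z) acts on
  them modulo 1 through matrices modulo 2, which permute the three nonzero classes, and an integer
  shift then costs only a fourth root of unity.\<close>

definition qpoch :: "complex \<Rightarrow> complex \<Rightarrow> complex" where
  "qpoch a q = (\<Prod>n. 1 - a * q ^ n)"

lemma convergent_qpoch:
  fixes a q :: complex
  assumes "norm q < 1"
  shows "convergent_prod (\<lambda>n. 1 - a * q ^ n)"
proof -
  have "summable (\<lambda>n. norm (1 - a * q ^ n - 1))"
    using assms by (simp add: norm_mult norm_power)
  then show ?thesis
    by (intro abs_convergent_prod_imp_convergent_prod summable_imp_abs_convergent_prod)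
qed

lemma qpoch_LIMSEQ:
  assumes "norm q < 1"
  shows "(\<lambda>n. \<Prod>i<n. 1 - a * q ^ i) \<longlonglongrightarrow> qpoch a q"
  using convergent_prod_LIMSEQ[OF convergent_qpoch[OF assms]]
  unfolding qpoch_def LIMSEQ_lessThan_iff_atMost .

lemma qpoch_rec:
  assumes "norm q < 1"
  shows "qpoch a q = (1 - a) * qpoch (a * q) q"
proof -
  have "qpoch a q = (\<Prod>k<1. 1 - a * q ^ k) * (\<Prod>k. 1 - a * q ^ (k + 1))"
    unfolding qpoch_def
    by (rule has_prod_unique[symmetric], rule has_prod_ignore_initial_segment', rule convergent_qpoch[OF assms])
  then show ?thesis
    by (simp add: qpoch_def mult.assoc)
qed

text \<open>A convergent product in the sense of \<open>convergent_prod\<close> can vanish only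
  through a vanishing factor; this later locates all zeros of theta.\<close>

lemma qpoch_eq_0_iff:
  assumes "norm q < 1"
  shows "qpoch a q = 0 \<longleftrightarrow> (\<exists>n. a * q ^ n = 1)"
proof
  assume "qpoch a q = 0"
  then show "\<exists>n. a * q ^ n = 1"
    using prodinf_nonzero[OF convergent_qpoch[OF assms, of a]] unfolding qpoch_def by fastforce
next
  assume "\<exists>n. a * q ^ n = 1"
  then obtain n where n: "a * q ^ n = 1" by blast
  have "eventually (\<lambda>m. (\<Prod>i<m. 1 - a * q ^ i) = 0) sequentially"
    using eventually_gt_at_top[of n]
  proof eventually_elim
    case (elim m)
    with n show ?case by (auto intro!: prod_zero bexI[of _ n])
  qed
  then have "(\<lambda>m. \<Prod>i<m. 1 - a * q ^ i) \<longlonglongrightarrow> 0"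
    by (rule tendsto_eventually)
  with qpoch_LIMSEQ[OF assms, of a] show "qpoch a q = 0"
    using LIMSEQ_unique by blast
qed

lemma qpoch_nonzero:
  assumes "norm q < 1" "norm a < 1"
  shows "qpoch a q \<noteq> 0"
proof -
  have "norm (a * q ^ n) < 1" for n
  proof -
    have "norm (a * q ^ n) = norm a * norm q ^ n" by (simp add: norm_mult norm_power)
    also have "\<dots> \<le> norm a * 1"
      using assms by (intro mult_left_mono power_le_one) auto
    finally show ?thesis using assms by simp
  qed
  then have "a * q ^ n \<noteq> 1" for n
    by (metis norm_one less_irrefl)
  then show ?thesis
    by (simp add: qpoch_eq_0_iff assms)
qed

text \<open>On a closed ball \<open>norm (q x)\<close> attains a maximum below 1, which gives a
  geometric majorant and hence uniform convergence of the partial products. Both arguments may vary: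
  theta moves \<open>a\<close> at fixed \<open>q\<close>, while eta and the cusp expansions move
  both.\<close>

lemma holomorphic_on_qpoch:
  assumes S: "open S" and a: "a holomorphic_on S" and q: "q holomorphic_on S"
    and lt: "\<And>x. x \<in> S \<Longrightarrow> norm (q x) < 1"
  shows "(\<lambda>x. qpoch (a x) (q x)) holomorphic_on S"
proof (rule holomorphic_uniform_sequence[OF S, where f = "\<lambda>n x. \<Prod>i<n. 1 - a x * q x ^ i"])
  show "(\<lambda>x. \<Prod>i<n. 1 - a x * q x ^ i) holomorphic_on S" for n
    by (intro holomorphic_intros a q)
next
  fix x assume "x \<in> S"
  then obtain d where d: "d > 0" "cball x d \<subseteq> S"
    using S open_contains_cball by blast
  have cq: "continuous_on (cball x d) q" and ca: "continuous_on (cball x d) a"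
    using a q d by (meson holomorphic_on_imp_continuous_on holomorphic_on_subset)+
  have "continuous_on (cball x d) (\<lambda>z. norm (q z))"
    by (intro continuous_intros cq)
  then obtain y where y: "y \<in> cball x d" "\<forall>z\<in>cball x d. norm (q z) \<le> norm (q y)"
    using continuous_attains_sup[of "cball x d" "\<lambda>z. norm (q z)"] d by fastforce
  have "bounded (a ` cball x d)"
    by (intro compact_imp_bounded compact_continuous_image ca) auto
  then obtain B where B: "\<And>z. z \<in> cball x d \<Longrightarrow> norm (a z) \<le> B"
    unfolding bounded_iff by blast
  have r: "norm (q y) < 1" using y d lt by blast
  have "uniformly_convergent_on (cball x d) (\<lambda>N z. \<Prod>n<N. 1 + (- (a z * q z ^ n)))"
  proof (rule uniformly_convergent_on_prod)
    show "uniformly_convergent_on (cball x d) (\<lambda>N z. \<Sum>n<N. norm (- (a z * q z ^ n)))"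
    proof (rule Weierstrass_m_test')
      show "norm (norm (- (a z * q z ^ n))) \<le> B * norm (q y) ^ n" if "z \<in> cball x d" for n z
        using B[OF that] y that
        by (auto simp: norm_mult norm_power intro!: mult_mono power_mono intro: order_trans[OF norm_ge_zero])
      show "summable (\<lambda>n. B * norm (q y) ^ n)"
        using r by (intro summable_mult summable_geometric) auto
    qed
  qed (auto intro!: continuous_intros cq ca)
  then have "uniform_limit (cball x d) (\<lambda>N z. \<Prod>n<N. 1 - a z * q z ^ n)
      (\<lambda>z. lim (\<lambda>N. \<Prod>n<N. 1 - a z * q z ^ n)) sequentially"
    by (simp add: uniformly_convergent_uniform_limit_iff)
  moreover have "lim (\<lambda>N. \<Prod>n<N. 1 - a z * q z ^ n) = qpoch (a z) (q z)" if "z \<in> cball x d" for z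
    using that d lt by (intro limI qpoch_LIMSEQ) auto
  ultimately have "uniform_limit (cball x d) (\<lambda>N z. \<Prod>n<N. 1 - a z * q z ^ n)
      (\<lambda>z. qpoch (a z) (q z)) sequentially"
    by (subst uniform_limit_cong'[OF refl, symmetric]) simp_all
  then show "\<exists>d>0. cball x d \<subseteq> S \<and> uniform_limit (cball x d)
      (\<lambda>N z. \<Prod>n<N. 1 - a z * q z ^ n)
      (\<lambda>z. qpoch (a z) (q z)) sequentially"
    using d by blast
qed

lemma qpoch_prod:
  assumes "norm q < 1"
  shows "(\<Prod>i\<in>I. qpoch (f i) q) = (\<Prod>n. \<Prod>i\<in>I. 1 - f i * q ^ n)"
  unfolding qpoch_def by (rule prodinf_prod[symmetric]) (rule convergent_qpoch[OF assms])

lemma qpoch_mult_minus: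
  assumes "norm q < 1"
  shows "qpoch a q * qpoch (- a) q = qpoch (a\<^sup>2) (q\<^sup>2)"
  unfolding qpoch_def
  by (subst prodinf_mult) (auto simp: convergent_qpoch[OF assms] convergent_qpoch[OF assms, of "-a",
      simplified] algebra_simps power2_eq_square power_mult_distrib intro!: prodinf_cong)

lemma qpoch_split_even_odd:
  assumes "norm q < 1"
  shows "qpoch a (q\<^sup>2) * qpoch (a * q) (q\<^sup>2) = qpoch a q"
proof -
  have q2: "norm (q\<^sup>2) < 1"
    using assms by (simp add: norm_power power_less_one_iff abs_square_less_1)
  have "(\<Prod>i<2*n. 1 - a * q ^ i) =
      (\<Prod>i<n. 1 - a * (q\<^sup>2) ^ i) * (\<Prod>i<n. 1 - a * q * (q\<^sup>2) ^ i)" for n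
    by (induction n) (simp_all add: power_mult[symmetric] mult_ac)
  moreover have "(\<lambda>n. \<Prod>i<2*n. 1 - a * q ^ i) \<longlonglongrightarrow> qpoch a q"
    using LIMSEQ_subseq_LIMSEQ[OF qpoch_LIMSEQ[OF assms, of a], of "\<lambda>n. 2 * n"]
    by (auto simp: strict_mono_def o_def)
  moreover have "(\<lambda>n. (\<Prod>i<n. 1 - a * (q\<^sup>2) ^ i) * (\<Prod>i<n. 1 - a * q * (q\<^sup>2) ^ i))
     \<longlonglongrightarrow> qpoch a (q\<^sup>2) * qpoch (a * q) (q\<^sup>2)"
    by (intro tendsto_intros qpoch_LIMSEQ q2)
  ultimately show ?thesis
    using LIMSEQ_unique by fastforce
qed

text \<open>Euler's identity between partitions into odd parts and into distinct parts. It later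
  makes the products at the three half-periods multiply to 1.\<close>

lemma qpoch_Euler:
  assumes "norm q < 1"
  shows "qpoch q (q\<^sup>2) * qpoch (- q) q = 1"
proof -
  have q2: "norm (q\<^sup>2) < 1"
    using assms by (simp add: norm_power power_less_one_iff abs_square_less_1)
  have "qpoch q q * 1 = qpoch q q * (qpoch q (q\<^sup>2) * qpoch (- q) q)"
    using qpoch_split_even_odd[OF assms, of q] qpoch_mult_minus[OF assms, of q]
    by (metis power2_eq_square mult.assoc mult.commute mult.right_neutral)
  then show ?thesis
    using qpoch_nonzero[OF assms assms] by (metis mult_cancel_left)
qed

section \<open>The theta function\<close>

definition e2pi :: "complex \<Rightarrow> complex" where
  "e2pi x = exp (2 * of_real pi * \<i> * x)"

lemma norm_e2pi_less_1: "Im z > 0 \<Longrightarrow> norm (e2pi z) < 1"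
  by (simp add: e2pi_def norm_exp_eq_Re)

lemma e2pi_nonzero [simp]: "e2pi x \<noteq> 0"
  by (simp add: e2pi_def)

lemma e2pi_0 [simp]: "e2pi 0 = 1"
  by (simp add: e2pi_def)

lemma e2pi_add: "e2pi (x + y) = e2pi x * e2pi y"
  by (simp add: e2pi_def exp_add distrib_left)

lemma e2pi_minus: "e2pi (- x) = inverse (e2pi x)"
  by (simp add: e2pi_def exp_minus)

lemma e2pi_of_nat_mult: "e2pi (of_nat n * z) = e2pi z ^ n"
  by (induction n) (simp_all add: distrib_right e2pi_add)

lemma e2pi_powi: "e2pi x powi n = e2pi (of_int n * x)"
  by (simp add: e2pi_def exp_power_int mult_ac)

lemma e2pi_sum: "e2pi (\<Sum>i\<in>I. f i) = (\<Prod>i\<in>I. e2pi (f i))"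
  by (induction I rule: infinite_finite_induct) (auto simp: e2pi_add)

lemma e2pi_eq_1_iff: "e2pi x = 1 \<longleftrightarrow> x \<in> \<int>"
proof
  assume "e2pi x = 1"
  then obtain n :: int where "Re (2 * of_real pi * \<i> * x) = 0"
    "Im (2 * of_real pi * \<i> * x) = of_int (2 * n) * pi"
    unfolding exp_eq_1 e2pi_def by blast
  then have "x = of_int n"
    by (simp add: complex_eq_iff)
  then show "x \<in> \<int>" by simp
next
  assume "x \<in> \<int>"
  then obtain n where "x = of_int n" by (auto elim: Ints_cases)
  then show "e2pi x = 1"
    by (auto simp: e2pi_def exp_eq_1)
qed

lemma e2pi_of_int [simp]: "e2pi (of_int n) = 1"
  by (simp add: e2pi_eq_1_iff)

lemma e2pi_1 [simp]: "e2pi 1 = 1"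
  by (simp add: e2pi_eq_1_iff)

lemma e2pi_add_of_int: "e2pi (x + of_int n) = e2pi x"
  by (simp add: e2pi_add)

lemma e2pi_half [simp]: "e2pi (1 / 2) = -1"
  by (simp add: e2pi_def)

lemma e2pi_half_of_int: "e2pi (of_int n / 2) = (-1) powi n"
proof (cases "even n")
  case True
  then obtain m where "n = 2 * m" by blast
  then show ?thesis by (simp add: power_int_mult)
next
  case False
  then obtain m where m: "n = 2 * m + 1" by (auto elim: oddE)
  have "e2pi (of_int n / 2) = e2pi (1 / 2 + of_int m)"
    by (simp add: m add_divide_distrib add.commute)
  then show ?thesis using False by (simp add: e2pi_add_of_int)
qed

lemma holomorphic_on_e2pi [holomorphic_intros]:
  "f holomorphic_on S \<Longrightarrow> (\<lambda>x. e2pi (f x)) holomorphic_on S"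
  unfolding e2pi_def by (intro holomorphic_intros)

(* A constant multiple of theta_1(w, z) / eta(z)^3, normalised so that the derivative in w at 0 does
   not depend on z. *)
definition jtheta :: "complex \<Rightarrow> complex \<Rightarrow> complex" where
  "jtheta w z = e2pi (- (w / 2)) * qpoch (e2pi w) (e2pi z) * qpoch (e2pi (z - w)) (e2pi z) /
     (qpoch (e2pi z) (e2pi z))\<^sup>2"

lemma jtheta_add_1: "jtheta (w + 1) z = - jtheta w z"
proof -
  have "e2pi (w + 1) = e2pi w" "e2pi (z - (w + 1)) = e2pi (z - w)"
    using e2pi_add_of_int[of w 1] e2pi_add_of_int[of "z - w" "-1"] by (simp_all add: diff_diff_eq)
  moreover have "- ((w + 1) / 2) = - (w / 2) + (1 / 2 + of_int (- 1))"
    by (simp add: field_simps)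
  then have "e2pi (- ((w + 1) / 2)) = - e2pi (- (w / 2))"
    by (simp only: e2pi_add e2pi_half e2pi_of_int) simp
  ultimately show ?thesis by (simp add: jtheta_def)
qed

text \<open>Adding \<open>z\<close> to \<open>w\<close> removes the factor \<open>1 - e2pi w\<close>
  from the first product and adds \<open>1 - e2pi (- w)\<close> to the second; the quotient of the
  two is \<open>- e2pi (- w)\<close>.\<close>

lemma jtheta_add_tau:
  assumes "Im z > 0"
  shows "jtheta (w + z) z = - e2pi (- w - z / 2) * jtheta w z"
proof -
  let ?q = "e2pi z" and ?u = "e2pi w"
  note q = norm_e2pi_less_1[OF assms]
  have 1: "qpoch ?u ?q = (1 - ?u) * qpoch (?u * ?q) ?q"
    by (rule qpoch_rec[OF q])
  have 2: "qpoch (e2pi (- w)) ?q = (1 - e2pi (- w)) * qpoch (e2pi (- w) * ?q) ?q"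
    by (rule qpoch_rec[OF q])
  have 3: "1 - e2pi (- w) = - e2pi (- w) * (1 - ?u)"
    by (simp add: e2pi_minus field_simps)
  have 4: "e2pi (z - w) = e2pi (- w) * ?q"
    unfolding e2pi_add[symmetric] by simp
  have "jtheta (w + z) z = e2pi (- (w / 2)) * e2pi (- (z / 2)) * qpoch (?u * ?q) ?q
      * qpoch (e2pi (- w)) ?q / (qpoch ?q ?q)\<^sup>2"
    unfolding jtheta_def e2pi_add[symmetric] by (simp add: add_divide_distrib)
  also have "\<dots> = - e2pi (- w) * e2pi (- (z / 2)) * (e2pi (- (w / 2)) * ((1 - ?u) * qpoch (?u
      * ?q) ?q) * qpoch (e2pi (- w) * ?q) ?q / (qpoch ?q ?q)\<^sup>2)"
    unfolding 2 3 by (simp only: mult_minus_left mult_minus_right times_divide_eq_right minus_divide_left mult_ac)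
  also have "\<dots> = - (e2pi (- w) * e2pi (- (z / 2))) * jtheta w z"
    unfolding jtheta_def 1 4 by simp
  also have "e2pi (- w) * e2pi (- (z / 2)) = e2pi (- w - z / 2)"
    unfolding e2pi_add[symmetric] by simp
  finally show ?thesis .
qed

lemma jtheta_add_int: "jtheta (w + of_int n) z = (-1) powi n * jtheta w z"
proof (induction n arbitrary: w rule: int_induct[where k = 0])
  case base
  show ?case by simp
next
  case (step1 i)
  then show ?case
    using jtheta_add_1[of "w + of_int i" z] by (simp add: power_int_add add_ac)
next
  case (step2 i)
  then show ?case
    using jtheta_add_1[of "w + of_int (i - 1)" z] by (simp add: power_int_diff algebra_simps)
qed

lemma jtheta_add_int_tau:
  assumes "Im z > 0"
  shows "jtheta (w + of_int m * z) z =
      (-1) powi m * e2pi (- (of_int m)\<^sup>2 * z / 2 - of_int m * w) * jtheta w z"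
proof (induction m rule: int_induct[where k = 0])
  case base
  show ?case by simp
next
  case (step1 i)
  have "jtheta (w + of_int (i + 1) * z) z = jtheta (w + of_int i * z + z) z"
    by (simp add: algebra_simps)
  also have "\<dots> = - e2pi (- (w + of_int i * z) - z / 2) * ((-1) powi i * e2pi (- (of_int i)\<^sup>2
      * z / 2 - of_int i * w) * jtheta w z)"
    by (simp only: jtheta_add_tau[OF assms] step1)
  also have "\<dots> = (-1) powi (i + 1) * (e2pi (- (w + of_int i * z) - z / 2)
      * e2pi (- (of_int i)\<^sup>2 * z / 2 - of_int i * w)) * jtheta w z"
    by (simp add: power_int_add)
  also have "\<dots> = (-1) powi (i + 1) * e2pi (- (of_int (i + 1))\<^sup>2 * z / 2 - of_int (i + 1) * w)
      * jtheta w z"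
    unfolding e2pi_add[symmetric]
    by (intro arg_cong2[where f = "(*)"] arg_cong[where f = e2pi] refl) (simp add: field_simps power2_eq_square)
  finally show ?case .
next
  case (step2 i)
  have "jtheta (w + of_int i * z) z = jtheta (w + of_int (i - 1) * z + z) z"
    by (simp add: algebra_simps)
  also have "\<dots> = - e2pi (- (w + of_int (i - 1) * z) - z / 2) * jtheta (w + of_int (i - 1) * z) z"
    by (rule jtheta_add_tau[OF assms])
  finally have "- e2pi (w + of_int (i - 1) * z + z / 2) * jtheta (w + of_int i * z) z =
       (e2pi (w + of_int (i - 1) * z + z / 2) * e2pi (- (w + of_int (i - 1) * z) - z / 2)) *
         jtheta (w + of_int (i - 1) * z) z"
    by (simp only: mult_minus_left mult_minus_right minus_minus mult.assoc)
  then have "jtheta (w + of_int (i - 1) * z) z =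
      - e2pi (w + of_int (i - 1) * z + z / 2) * jtheta (w + of_int i * z) z"
    unfolding e2pi_add[symmetric] by (simp only: algebra_simps) simp
  also have "\<dots> = (-1) powi (i - 1) * (e2pi (w + of_int (i - 1) * z + z / 2)
      * e2pi (- (of_int i)\<^sup>2 * z / 2 - of_int i * w)) * jtheta w z"
    unfolding step2 by (simp add: power_int_diff)
  also have "\<dots> = (-1) powi (i - 1) * e2pi (- (of_int (i - 1))\<^sup>2 * z / 2 - of_int (i - 1) * w)
      * jtheta w z"
    unfolding e2pi_add[symmetric]
    by (intro arg_cong2[where f = "(*)"] arg_cong[where f = e2pi] refl) (simp add: field_simps power2_eq_square)
  finally show ?case .
qed

lemma jtheta_quasi_periodic:
  assumes "Im z > 0"
  shows "jtheta (w + of_int m * z + of_int n) z =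
     (-1) powi (m + n) * e2pi (- (of_int m)\<^sup>2 * z / 2 - of_int m * w) * jtheta w z"
  unfolding jtheta_add_int jtheta_add_int_tau[OF assms] by (simp add: power_int_add)

lemma holomorphic_on_jtheta:
  assumes S: "open S" and f: "f holomorphic_on S" and g: "g holomorphic_on S"
    and Im: "\<And>x. x \<in> S \<Longrightarrow> Im (g x) > 0"
  shows "(\<lambda>x. jtheta (f x) (g x)) holomorphic_on S"
  unfolding jtheta_def
  by (intro holomorphic_intros holomorphic_on_qpoch S f g)
     (auto simp: norm_e2pi_less_1 Im qpoch_nonzero)

text \<open>The first product vanishes at the lattice points with \<open>m \<le> 0\<close>, the
  second at those with \<open>m \<ge> 1\<close>.\<close>

lemma jtheta_eq_0_iff:
  assumes "Im z > 0"
  shows "jtheta w z = 0 \<longleftrightarrow> (\<exists>m n :: int. w = of_int m * z + of_int n)"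
proof
  note q = norm_e2pi_less_1[OF assms]
  assume "jtheta w z = 0"
  then have "qpoch (e2pi w) (e2pi z) = 0 \<or> qpoch (e2pi (z - w)) (e2pi z) = 0"
    using qpoch_nonzero[OF q q] by (auto simp: jtheta_def)
  then obtain n where "e2pi (w + of_nat n * z) = 1 \<or> e2pi (z - w + of_nat n * z) = 1"
    unfolding qpoch_eq_0_iff[OF q] e2pi_of_nat_mult[symmetric] e2pi_add[symmetric] by blast
  then have "w + of_nat n * z \<in> \<int> \<or> z - w + of_nat n * z \<in> \<int>"
    unfolding e2pi_eq_1_iff .
  then show "\<exists>m n :: int. w = of_int m * z + of_int n"
  proof
    assume "w + of_nat n * z \<in> \<int>"
    then obtain k :: int where k: "w + of_nat n * z = of_int k" by (auto elim: Ints_cases)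
    show ?thesis
      by (rule exI[of _ "- int n"], rule exI[of _ k], simp add: k[symmetric])
  next
    assume "z - w + of_nat n * z \<in> \<int>"
    then obtain k :: int where k: "z - w + of_nat n * z = of_int k" by (auto elim: Ints_cases)
    then have "w = of_int (int n + 1) * z + of_int (- k)"
      by (simp add: algebra_simps flip: k)
    then show ?thesis by blast
  qed
next
  assume "\<exists>m n :: int. w = of_int m * z + of_int n"
  then obtain m n :: int where w: "w = of_int m * z + of_int n" by blast
  have "qpoch 1 (e2pi z) = 0"
    using norm_e2pi_less_1[OF assms] by (auto simp: qpoch_eq_0_iff intro!: exI[of _ 0])
  then have "jtheta 0 z = 0"
    by (simp add: jtheta_def)
  then show "jtheta w z = 0"
    using jtheta_quasi_periodic[OF assms, of 0 m n] by (simp add: w)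
qed

lemma jtheta_has_field_derivative_0:
  assumes "Im z > 0"
  shows "((\<lambda>w. jtheta w z) has_field_derivative - (2 * of_real pi * \<i>)) (at 0)"
proof -
  let ?q = "e2pi z"
  note q = norm_e2pi_less_1[OF assms]
  \<comment> \<open>\<open>U\<close> is \<open>jtheta\<close> without the factor
    \<open>1 - e2pi w\<close>, the only one that vanishes at 0. The squared denominator of
    \<open>jtheta\<close> is there to give \<open>U 0 = 1\<close>.\<close>
  define U where "U w = e2pi (- (w / 2)) * qpoch (e2pi w * ?q) ?q * qpoch (e2pi (z - w)) ?q
      / (qpoch ?q ?q)\<^sup>2" for w
  have U: "U holomorphic_on UNIV"
    unfolding U_def
    by (intro holomorphic_intros holomorphic_on_qpoch) (auto simp: q qpoch_nonzero)
  have "U 0 = 1"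
    using qpoch_nonzero[OF q q] by (simp add: U_def power2_eq_square)
  have eq: "jtheta w z = (1 - e2pi w) * U w" for w
    unfolding jtheta_def U_def qpoch_rec[OF q, of "e2pi w"] by simp
  have "(U has_field_derivative deriv U 0) (at 0)"
    using U by (simp add: holomorphic_derivI)
  then show ?thesis
    unfolding eq by (auto intro!: derivative_eq_intros simp: \<open>U 0 = 1\<close> e2pi_def)
qed

section \<open>Uniqueness of theta by Liouville's theorem\<close>

lemma lattice_coordinates:
  assumes "Im z > 0"
  obtains s t :: real where "w = of_real s * z + of_real t"
proof
  show "w = of_real (Im w / Im z) * z + of_real (Re w - Im w / Im z * Re z)"
    using assms by (simp add: complex_eq_iff)
qed

text \<open>The codomain is arbitrary so that the lemma also applies to a predicate such as
  \<open>\<psi> w = 0\<close>, which is periodic even when \<open>\<psi>\<close> is only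
  quasi-periodic.\<close>

lemma lattice_periodic:
  fixes f :: "complex \<Rightarrow> 'a"
  assumes "\<And>w. f (w + 1) = f w" and "\<And>w. f (w + z) = f w"
  shows "f (w + of_int m * z + of_int n) = f w"
proof -
  have *: "f (w + of_int n * c) = f w" if per: "\<And>w. f (w + c) = f w" for c n w
  proof (induction n rule: int_induct[where k = 0])
    case (step1 i)
    then show ?case using per[of "w + of_int i * c"] by (simp add: algebra_simps)
  next
    case (step2 i)
    then show ?case using per[of "w + of_int (i - 1) * c"] by (simp add: algebra_simps)
  qed simp
  show ?thesis
    using *[of 1 "w + of_int m * z" n] *[of z w m] assms by simp
qed

text \<open>All values are already taken on the compact period parallelogram \<open>K\<close>, so
  the function is bounded.\<close>

lemma doubly_periodic_entire_constant:
  assumes z: "Im z > 0" and hol: "R holomorphic_on UNIV"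
    and 1: "\<And>w. R (w + 1) = R w" and 2: "\<And>w. R (w + z) = R w"
  shows "R w = R 0"
proof -
  define K where "K = (\<lambda>(s, t). complex_of_real s * z + of_real t) ` ({0..1} \<times> {0..1})"
  have "compact K"
    unfolding K_def by (intro compact_continuous_image compact_Times)
      (auto simp: case_prod_beta intro!: continuous_intros)
  then have bdd: "bounded (R ` K)"
    using hol by (intro compact_imp_bounded compact_continuous_image)
      (auto intro: holomorphic_on_imp_continuous_on holomorphic_on_subset)
  have "range R \<subseteq> R ` K"
  proof (intro image_subsetI)
    fix w
    obtain s t where w: "w = of_real s * z + of_real t"
      using lattice_coordinates[OF z] .
    have "w = of_real (frac s) * z + of_real (frac t) + of_int \<lfloor>s\<rfloor> * z + of_int \<lfloor>t\<rfloor>"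
      by (simp add: w frac_def algebra_simps)
    then have "R w = R (of_real (frac s) * z + of_real (frac t))"
      using lattice_periodic[of R z, OF 1 2] by metis
    moreover have "frac s \<in> {0..1}" "frac t \<in> {0..1}"
      by (auto intro: less_imp_le frac_lt_1)
    ultimately show "R w \<in> R ` K"
      unfolding K_def by (auto intro!: image_eqI[of _ _ "(frac s, frac t)"])
  qed
  then have "bounded (range R)"
    using bdd bounded_subset by blast
  then show ?thesis
    using Liouville_theorem[OF hol] by (auto simp: constant_on_def)
qed

text \<open>The quotient of two functions with the same quasi-periods is doubly periodic. Theta
  vanishes only on the lattice and simply at 0, and \<open>\<psi>\<close> vanishes there too, so the
  quotient is entire and constant; the derivatives at 0 identify the constant.\<close>

lemma jtheta_unique:
  assumes z: "Im z > 0" and hol: "\<psi> holomorphic_on UNIV"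
    and 1: "\<And>w. \<psi> (w + 1) = - \<psi> w"
    and 2: "\<And>w. \<psi> (w + z) = - e2pi (- w - z / 2) * \<psi> w"
    and D: "(\<psi> has_field_derivative - (2 * of_real pi * \<i>) * C) (at 0)" and 0: "\<psi> 0 = 0"
  shows "\<psi> w = C * jtheta w z"
proof -
  let ?\<phi> = "\<lambda>w. jtheta w z"
  have hol\<phi>: "?\<phi> holomorphic_on UNIV"
    by (intro holomorphic_on_jtheta holomorphic_intros) (auto simp: z)
  have \<phi>0: "?\<phi> 0 = 0"
    unfolding jtheta_eq_0_iff[OF z] by (intro exI[of _ 0]) simp
  \<comment> \<open>At a zero of theta, division would return the default value 0. The value
    \<open>C\<close> is the limit of the quotient at 0, and by periodicity at every lattice
    point.\<close>
  define R where "R w = (if ?\<phi> w = 0 then C else \<psi> w / ?\<phi> w)" for w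
  have R1: "R (w + 1) = R w" for w
    by (simp add: R_def jtheta_add_1 1)
  have R2: "R (w + z) = R w" for w
    by (simp add: R_def jtheta_add_tau[OF z] 2)
  have "((\<lambda>w. ?\<phi> w / w) \<longlongrightarrow> - (2 * of_real pi * \<i>)) (at 0)"
    using jtheta_has_field_derivative_0[OF z] \<phi>0 by (simp add: has_field_derivative_iff)
  then have "eventually (\<lambda>w. ?\<phi> w / w \<noteq> 0) (at 0)"
    by (rule tendsto_imp_eventually_ne) auto
  then have \<phi>_nz: "eventually (\<lambda>w. ?\<phi> w \<noteq> 0) (at 0)"
    by eventually_elim auto
  have lim: "(R \<longlongrightarrow> C) (at 0)"
  proof -
    have "((\<lambda>w. (\<psi> w / w) / (?\<phi> w / w)) \<longlongrightarrow> (- (2 * of_real pi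
        * \<i>) * C) / (- (2 * of_real pi * \<i>))) (at 0)"
      using D jtheta_has_field_derivative_0[OF z] 0 \<phi>0
      by (intro tendsto_divide) (simp_all add: has_field_derivative_iff)
    then have "((\<lambda>w. (\<psi> w / w) / (?\<phi> w / w)) \<longlongrightarrow> C) (at 0)"
      by simp
    moreover from \<phi>_nz have "eventually (\<lambda>w. (\<psi> w / w) / (?\<phi> w / w) = R w) (at 0)"
      using eventually_neq_at_within[of 0 0 UNIV] by eventually_elim (auto simp: R_def)
    ultimately show ?thesis
      by (rule Lim_transform_eventually)
  qed
  have an: "R analytic_on {w}" if "?\<phi> w \<noteq> 0" for w
  proof -
    have "open {w. ?\<phi> w \<noteq> 0}"
      using hol\<phi> by (intro open_Collect_neq continuous_intros holomorphic_on_imp_continuous_on)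
    moreover have "R holomorphic_on {w. ?\<phi> w \<noteq> 0}"
    proof -
      have "(\<lambda>w. \<psi> w / ?\<phi> w) holomorphic_on {w. ?\<phi> w \<noteq> 0}"
        by (intro holomorphic_intros holomorphic_on_subset[OF hol] holomorphic_on_subset[OF hol\<phi>]) auto
      then show ?thesis
        by (rule holomorphic_transform) (simp add: R_def)
    qed
    ultimately show ?thesis
      using that by (meson analytic_at mem_Collect_eq)
  qed
  have an0: "R analytic_on {0}"
  proof -
    obtain r where r: "r > 0" "\<And>w. w \<in> ball 0 r - {0} \<Longrightarrow> ?\<phi> w \<noteq> 0"
      using \<phi>_nz unfolding eventually_at by (auto simp: dist_norm)
    have holR: "R holomorphic_on ball 0 r - {0}"
      by (rule analytic_imp_holomorphic) (use an r analytic_on_analytic_at in blast)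
    moreover have "R 0 = C" using \<phi>0 by (simp add: R_def)
    then have "continuous (at 0) R"
      using lim by (simp add: continuous_at)
    moreover have "isCont R w" if "w \<in> ball 0 r - {0}" for w
      using an[OF r(2)[OF that]] by (rule analytic_at_imp_isCont)
    ultimately have "isCont R w" if "w \<in> ball 0 r" for w
      using that by (cases "w = 0") auto
    then have "continuous_on (ball 0 r) R"
      by (simp add: continuous_at_imp_continuous_on)
    from no_isolated_singularity[OF this, of "{0}"] holR have "R holomorphic_on ball 0 r"
      by simp
    then show ?thesis
      using r by (meson analytic_at centre_in_ball open_ball)
  qed
  have Rint: "R (w + (of_int m * z + of_int n)) = R w" for w m n
    using lattice_periodic[of R z, OF R1 R2, of w m n] by (simp add: add_ac)
  have "R analytic_on {w}" for w
  proof (cases "?\<phi> w = 0")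
    case True
    then obtain m n :: int where w: "w = of_int m * z + of_int n"
      unfolding jtheta_eq_0_iff[OF z] by blast
    \<comment> \<open>A lattice translation carries the removable singularity at 0 to any other
      zero.\<close>
    have "(R \<circ> (\<lambda>x. x + (- w))) analytic_on {w}"
      by (rule analytic_on_compose_gen[where T = "{0}"]) (auto intro!: analytic_intros an0)
    moreover have "R \<circ> (\<lambda>x. x + (- w)) = R"
      using Rint[of _ "- m" "- n"] by (simp add: fun_eq_iff w o_def algebra_simps)
    ultimately show ?thesis by simp
  qed (rule an)
  then have "R holomorphic_on UNIV"
    using analytic_on_analytic_at analytic_imp_holomorphic by blast
  from doubly_periodic_entire_constant[OF z this R1 R2] have "R w = R 0" .
  then have R: "R w = C" using \<phi>0 by (simp add: R_def)
  show ?thesis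
  proof (cases "?\<phi> w = 0")
    case True
    then obtain m n :: int where w: "w = of_int m * z + of_int n"
      unfolding jtheta_eq_0_iff[OF z] by blast
    have "\<psi> w = 0"
      using lattice_periodic[of "\<lambda>w. \<psi> w = 0" z 0 m n] by (simp add: 1 2 0 w)
    with True show ?thesis by simp
  next
    case False
    with R show ?thesis by (simp add: R_def field_simps)
  qed
qed

section \<open>The modular transformation and Klein forms\<close>

lemma cz_d_nonzero:
  assumes "Im z > 0" and "c \<noteq> 0 \<or> d \<noteq> (0 :: int)"
  shows "of_int c * z + of_int d \<noteq> 0"
  using assms by (auto simp: complex_eq_iff)

lemma Im_moebius:
  fixes a b c d :: int
  assumes "a * d - b * c = 1"
  shows "Im ((of_int a * z + of_int b) / (of_int c * z + of_int d)) =
    Im z / (norm (of_int c * z + of_int d))\<^sup>2"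
proof -
  have "Im ((of_int a * z + of_int b) * cnj (of_int c * z + of_int d)) = of_int (a * d - b * c) * Im z"
    by (simp add: algebra_simps)
  then show ?thesis
    using complex_div_cnj[of "of_int a * z + of_int b" "of_int c * z + of_int d"] unfolding assms
    by (simp only: Im_divide_of_real flip: of_real_power)
qed

lemma jtheta_transform:
  fixes a b c d :: int
  assumes z: "Im z > 0" and det: "a * d - b * c = 1"
  defines "j \<equiv> of_int c * z + of_int d" and "\<tau> \<equiv> (of_int a * z + of_int b) /
      (of_int c * z + of_int d)"
  shows "jtheta (w / j) \<tau> = e2pi (of_int c * w\<^sup>2 / (2 * j)) * jtheta w z / j"
proof -
  have j: "j \<noteq> 0"
    unfolding j_def using det by (intro cz_d_nonzero z) auto
  have \<tau>: "Im \<tau> > 0"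
    using j z Im_moebius[OF det, of z] by (simp add: \<tau>_def j_def)
  have det': "of_int a * of_int d = (1 + of_int b * of_int c :: complex)"
    using det by (metis add.commute diff_add_cancel of_int_1 of_int_add of_int_mult)
  have j\<tau>: "j * \<tau> = of_int a * z + of_int b"
    using j unfolding \<tau>_def j_def by simp
  \<comment> \<open>In the lattice of \<open>\<tau>\<close>, \<open>1 / j\<close> and
    \<open>z / j\<close> have coordinates given by the inverse matrix. The periods 1 and
    \<open>z\<close> of the variable \<open>w\<close> thus become lattice shifts of
    \<open>w / j\<close>.\<close>
  have inv_j: "1 / j = - of_int c * \<tau> + of_int a"
  proof -
    have "j * (- of_int c * \<tau> + of_int a) = - of_int c * (of_int a * z + of_int b) + of_int a * j"
      unfolding j\<tau>[symmetric] by (simp add: algebra_simps)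
    also have "\<dots> = 1"
      using det' by (simp add: j_def algebra_simps)
    finally show ?thesis using j by (simp add: field_simps)
  qed
  have z_j: "z / j = of_int d * \<tau> - of_int b"
  proof -
    have "j * (of_int d * \<tau> - of_int b) = of_int d * (of_int a * z + of_int b) - of_int b * j"
      unfolding j\<tau>[symmetric] by (simp add: algebra_simps)
    also have "\<dots> = of_int a * of_int d * z - of_int b * of_int c * z"
      by (simp add: j_def algebra_simps)
    also have "\<dots> = z"
      unfolding det' by (simp add: algebra_simps)
    finally show ?thesis using j by (simp add: field_simps)
  qed
  \<comment> \<open>The Gaussian factor is chosen to turn the quasi-periods attached to
    \<open>\<tau>\<close> into those attached to \<open>z\<close>.\<close>
  define \<psi> where "\<psi> w = e2pi (- (of_int c * w\<^sup>2 / (2 * j))) * jtheta (w / j) \<tau>" for w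
  have "\<psi> w = 1 / j * jtheta w z"
  proof (rule jtheta_unique[OF z])
    show "\<psi> holomorphic_on UNIV"
      unfolding \<psi>_def using j by (intro holomorphic_intros holomorphic_on_jtheta) (auto simp: \<tau>)
    show "\<psi> (w + 1) = - \<psi> w" for w
    proof -
      have "(w + 1) / j = w / j + of_int (- c) * \<tau> + of_int a"
        by (simp add: add_divide_distrib inv_j)
      then have "\<psi> (w + 1) = e2pi (- (of_int c * (w + 1)\<^sup>2 / (2 * j))) *
          e2pi (- (of_int (- c))\<^sup>2 * \<tau> / 2 - of_int (- c) * (w / j)) * (-1) powi (- c + a)
              * jtheta (w / j) \<tau>"
        unfolding \<psi>_def by (simp only: jtheta_quasi_periodic[OF \<tau>]) (simp only: mult_ac)
      also have "e2pi (- (of_int c * (w + 1)\<^sup>2 / (2 * j))) * e2pi (- (of_int (- c))\<^sup>2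
          * \<tau> / 2 - of_int (- c) * (w / j))
         = e2pi (- (of_int c * w\<^sup>2 / (2 * j))) * e2pi (of_int (- (a * c)) / 2)"
        unfolding e2pi_add[symmetric]
      proof (rule arg_cong[where f = e2pi])
        have "- (of_int c * (w + 1)\<^sup>2 / (2 * j)) + (- (of_int (- c))\<^sup>2 * \<tau> / 2
            - of_int (- c) * (w / j)) =
          - (of_int c * w\<^sup>2 / (2 * j)) - of_int c / 2 * (of_int c * \<tau> + 1 / j)"
          using j by (simp add: field_simps power2_eq_square)
        then show "- (of_int c * (w + 1)\<^sup>2 / (2 * j)) + (- (of_int (- c))\<^sup>2 * \<tau> / 2
            - of_int (- c) * (w / j)) =
          - (of_int c * w\<^sup>2 / (2 * j)) + of_int (- (a * c)) / 2"
          unfolding inv_j by simp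
      qed
      also have "\<dots> * (-1) powi (- c + a) = - e2pi (- (of_int c * w\<^sup>2 / (2 * j)))"
      proof -
        \<comment> \<open>Modulo 2 the exponent of the sign is
          \<open>a * c + a + c = (a + 1) * (c + 1) - 1\<close>, which is odd unless \<open>a\<close>
          and \<open>c\<close> are both even; the determinant rules that out. The same argument
          serves \<open>b\<close> and \<open>d\<close> below.\<close>
        have "odd a \<or> odd c"
        proof (rule ccontr)
          assume "\<not> ?thesis"
          then have "even (a * d - b * c)" by simp
          then show False unfolding det by simp
        qed
        then show ?thesis
          unfolding e2pi_half_of_int by (auto simp: power_int_minus_left)
      qed
      finally show ?thesis by (simp add: \<psi>_def)
    qed
    show "\<psi> (w + z) = - e2pi (- w - z / 2) * \<psi> w" for w
    proof -
      have "(w + z) / j = w / j + of_int d * \<tau> + of_int (- b)"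
        by (simp add: add_divide_distrib z_j)
      then have "\<psi> (w + z) = e2pi (- (of_int c * (w + z)\<^sup>2 / (2 * j))) *
          e2pi (- (of_int d)\<^sup>2 * \<tau> / 2 - of_int d * (w / j)) * (-1) powi (d + (- b))
              * jtheta (w / j) \<tau>"
        unfolding \<psi>_def by (simp only: jtheta_quasi_periodic[OF \<tau>]) (simp only: mult_ac)
      also have "e2pi (- (of_int c * (w + z)\<^sup>2 / (2 * j))) * e2pi (- (of_int d)\<^sup>2 * \<tau>
          / 2 - of_int d * (w / j))
         = e2pi (- (of_int c * w\<^sup>2 / (2 * j))) * e2pi (- w - z / 2) * e2pi (of_int (- (b * d)) / 2)"
        unfolding e2pi_add[symmetric]
      proof (rule arg_cong[where f = e2pi])
        have "- (of_int c * (w + z)\<^sup>2 / (2 * j)) + (- (of_int d)\<^sup>2 * \<tau> / 2 - of_int d * (w / j)) =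
           - (of_int c * w\<^sup>2 / (2 * j)) - w * ((of_int c * z + of_int d) / j) - of_int c * z * (z
               / j) / 2 - of_int d * (of_int d * \<tau>) / 2"
          using j by (simp add: field_simps power2_eq_square)
        also have "of_int d * \<tau> = z / j + of_int b"
          by (simp add: z_j)
        also have "- (of_int c * w\<^sup>2 / (2 * j)) - w * ((of_int c * z + of_int d) / j) - of_int c
            * z * (z / j) / 2 - of_int d * (z / j + of_int b) / 2 =
           - (of_int c * w\<^sup>2 / (2 * j)) - w * ((of_int c * z + of_int d) / j) - z * ((of_int c * z
               + of_int d) / j) / 2 - of_int d * of_int b / 2"
          using j by (simp add: field_simps)
        also have "(of_int c * z + of_int d) / j = 1"
          using j by (simp add: j_def)
        finally show "- (of_int c * (w + z)\<^sup>2 / (2 * j)) + (- (of_int d)\<^sup>2 * \<tau> / 2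
            - of_int d * (w / j)) =
          - (of_int c * w\<^sup>2 / (2 * j)) + (- w - z / 2) + of_int (- (b * d)) / 2"
          by (simp add: algebra_simps)
      qed
      also have "\<dots> * (-1) powi (d + (- b)) = - e2pi (- (of_int c * w\<^sup>2 / (2 * j))) * e2pi (- w - z / 2)"
      proof -
        have "odd b \<or> odd d"
        proof (rule ccontr)
          assume "\<not> ?thesis"
          then have "even (a * d - b * c)" by simp
          then show False unfolding det by simp
        qed
        then show ?thesis
          unfolding e2pi_half_of_int by (auto simp: power_int_minus_left)
      qed
      finally show ?thesis by (simp add: \<psi>_def)
    qed
    have jt0: "jtheta 0 \<tau> = 0"
      unfolding jtheta_eq_0_iff[OF \<tau>] by (intro exI[of _ 0]) simp
    then show "\<psi> 0 = 0" by (simp add: \<psi>_def)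
    \<comment> \<open>The chain rule for \<open>w / j\<close> is the source of the factor
      \<open>1 / j\<close>, hence of the weight -1 of Klein forms.\<close>
    have "((\<lambda>w. jtheta (w / j) \<tau>) has_field_derivative - (2 * of_real pi * \<i>) * (1 / j)) (at 0)"
      by (rule DERIV_chain2[where g = "\<lambda>w. w / j"])
        (use j jtheta_has_field_derivative_0[OF \<tau>] in \<open>auto intro!: derivative_eq_intros\<close>)
    then show "(\<psi> has_field_derivative - (2 * of_real pi * \<i>) * (1 / j)) (at 0)"
      unfolding \<psi>_def e2pi_def using j jt0
      by (auto intro!: derivative_eq_intros)
  qed
  then show ?thesis
    using j by (simp add: \<psi>_def e2pi_minus field_simps)
qed

text \<open>The exponential prefactor is made to absorb the Gaussian factor of
  \<open>jtheta_transform\<close>; in the product expansion it produces the usual leading power of q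
  with exponent \<open>a1 * (a1 - 1) / 2\<close>.\<close>

definition klein :: "real \<Rightarrow> real \<Rightarrow> complex \<Rightarrow> complex" where
  "klein a1 a2 z = e2pi (of_real a1 * (of_real a1 * z + of_real a2) / 2) * jtheta (of_real a1 * z + of_real a2) z"

text \<open>The characteristic is multiplied by the matrix as a row vector. With x' its new first
  entry and \<open>w\<close> the new argument, \<open>x + c * w = x' * j\<close>, so prefactor and
  Gaussian combine into the prefactor of the new Klein form.\<close>

lemma klein_transform:
  fixes a b c d :: int
  assumes z: "Im z > 0" and det: "a * d - b * c = 1"
  shows "klein x y ((of_int a * z + of_int b) / (of_int c * z + of_int d)) =
    klein (x * of_int a + y * of_int c) (x * of_int b + y * of_int d) z / (of_int c * z + of_int d)"
proof -
  define j where "j = of_int c * z + of_int d"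
  define \<tau> where "\<tau> = (of_int a * z + of_int b) / j"
  define w where "w = of_real (x * of_int a + y * of_int c) * z + of_real (x * of_int b + y * of_int d)"
  have j: "j \<noteq> 0"
    unfolding j_def using det by (intro cz_d_nonzero z) auto
  have det': "of_int a * of_int d = (1 + of_int b * of_int c :: complex)"
    using det by (metis add.commute diff_add_cancel of_int_1 of_int_add of_int_mult)
  have w: "of_real x * \<tau> + of_real y = w / j"
    using j unfolding \<tau>_def w_def by (simp add: field_simps) (simp add: j_def algebra_simps)
  have "of_real x + of_int c * w = of_real x * (of_int a * of_int d - of_int b * of_int c) + of_int c * w"
    unfolding det' by simp
  also have "\<dots> = of_real (x * of_int a + y * of_int c) * j"
    by (simp add: w_def j_def algebra_simps)
  finally have *: "of_real x + of_int c * w = of_real (x * of_int a + y * of_int c) * j" .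
  have "of_real x * (w / j) / 2 + of_int c * w\<^sup>2 / (2 * j) = (of_real x + of_int c * w) * w / (2 * j)"
    using j by (simp add: field_simps power2_eq_square)
  then have e: "of_real x * (w / j) / 2 + of_int c * w\<^sup>2 / (2 * j) =
      of_real (x * of_int a + y * of_int c) * w / 2"
    unfolding * using j by simp
  have "klein x y \<tau> = e2pi (of_real x * (w / j) / 2) * (e2pi (of_int c * w\<^sup>2 / (2 * j))
      * jtheta w z / j)"
    unfolding klein_def w using jtheta_transform[OF z det, of w] by (simp add: \<tau>_def j_def)
  also have "\<dots> = e2pi (of_real x * (w / j) / 2 + of_int c * w\<^sup>2 / (2 * j)) * jtheta w z / j"
    by (simp add: e2pi_add)
  finally show ?thesis
    unfolding e by (simp add: klein_def w_def \<tau>_def j_def)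
qed

text \<open>The prefactor cancels the \<open>z\<close>-dependent part of the quasi-periodicity. What
  remains is a constant, a root of unity when \<open>x\<close> and \<open>y\<close> are
  rational.\<close>

lemma klein_shift:
  fixes m n :: int
  assumes z: "Im z > 0"
  shows "klein (x + of_int m) (y + of_int n) z =
    (-1) powi (m * n + m + n) * e2pi (of_real (x * of_int n - y * of_int m) / 2) * klein x y z"
proof -
  define w where "w = of_real x * z + of_real y"
  have w': "of_real (x + of_int m) * z + of_real (y + of_int n) = w + of_int m * z + of_int n"
    by (simp add: w_def algebra_simps)
  have "klein (x + of_int m) (y + of_int n) z =
    (-1) powi (m + n) * (e2pi (of_real (x + of_int m) * (w + of_int m * z + of_int n) / 2) *
      e2pi (- (of_int m)\<^sup>2 * z / 2 - of_int m * w)) * jtheta w z"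
    unfolding klein_def w' jtheta_quasi_periodic[OF z] by simp
  also have "e2pi (of_real (x + of_int m) * (w + of_int m * z + of_int n) / 2)
      * e2pi (- (of_int m)\<^sup>2 * z / 2 - of_int m * w)
     = e2pi (of_int (m * n) / 2) * e2pi (of_real (x * of_int n - y * of_int m) / 2) * e2pi (of_real x * w / 2)"
    unfolding e2pi_add[symmetric]
    by (rule arg_cong[where f = e2pi]) (simp add: w_def field_simps power2_eq_square)
  finally show ?thesis
    unfolding e2pi_half_of_int klein_def w_def[symmetric] by (simp add: power_int_add)
qed

section \<open>Eta-quotients as products of Klein forms\<close>

lemma dedekind_eta_eq: "dedekind_eta z = e2pi (z / 24) * qpoch (e2pi z) (e2pi z)"
  unfolding dedekind_eta_def qpoch_def by (simp add: e2pi_def)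

lemma dedekind_eta_nonzero: "Im z > 0 \<Longrightarrow> dedekind_eta z \<noteq> 0"
  by (simp add: dedekind_eta_eq qpoch_nonzero norm_e2pi_less_1)

lemma holomorphic_on_dedekind_eta:
  assumes "open S" and "f holomorphic_on S" and "\<And>x. x \<in> S \<Longrightarrow> Im (f x) > 0"
  shows "(\<lambda>x. dedekind_eta (f x)) holomorphic_on S"
  unfolding dedekind_eta_eq
  by (intro holomorphic_intros holomorphic_on_qpoch assms) (auto simp: norm_e2pi_less_1 assms)

text \<open>This is the factorisation of T^n - 1 read at T = \<open>1 / X\<close>. The two sides are
  monic of degree \<open>n\<close> with the same \<open>n\<close> roots, so their difference has
  degree below \<open>n\<close> but at least \<open>n\<close> roots.\<close>

lemma prod_one_minus_roots_unity:
  assumes "n > 0"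
  shows "(\<Prod>r<n. 1 - X * e2pi (of_nat r / of_nat n)) = 1 - X ^ n"
proof (cases "X = 0")
  case False
  define \<zeta> where "\<zeta> r = e2pi (of_nat r / of_nat n)" for r :: nat
  have inj: "inj_on \<zeta> {..<n}"
  proof (rule inj_onI)
    fix r s assume rs: "r \<in> {..<n}" "s \<in> {..<n}" "\<zeta> r = \<zeta> s"
    have "e2pi (of_nat r / of_nat n - of_nat s / of_nat n) = 1"
      using rs(3) e2pi_add[of "of_nat r / of_nat n" "- (of_nat s / of_nat n)"]
      by (simp add: \<zeta>_def e2pi_minus)
    then have "of_nat r / of_nat n - of_nat s / of_nat n \<in> (\<int> :: complex set)"
      by (simp add: e2pi_eq_1_iff)
    then obtain k :: int where "of_nat r / of_nat n - of_nat s / of_nat n = (of_int k :: complex)"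
      by (auto elim: Ints_cases)
    then have "of_int (int r - int s) = (of_int (k * int n) :: complex)"
      using assms by (simp add: field_simps)
    then have "int r - int s = k * int n"
      by (simp only: of_int_eq_iff)
    moreover have "\<bar>int r - int s\<bar> < int n"
      using rs by auto
    ultimately have "\<bar>k\<bar> * int n < 1 * int n"
      by (simp add: abs_mult)
    then have "k = 0"
      using assms by (subst (asm) mult_less_cancel_right_pos) auto
    then show "r = s" using \<open>int r - int s = k * int n\<close> by simp
  qed
  have pow: "\<zeta> r ^ n = 1" for r
    unfolding \<zeta>_def e2pi_of_nat_mult[symmetric] using assms by (simp add: e2pi_eq_1_iff)
  define P where "P = (\<Prod>r<n. [:- \<zeta> r, 1:])"
  define Q where "Q = (Polynomial.monom 1 n - 1 :: complex poly)"
  have P: "degree P = n" "lead_coeff P = 1"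
    unfolding P_def by (subst degree_prod_eq_sum_degree) (auto simp: lead_coeff_prod)
  have "P - Q = 0"
  proof (rule ccontr)
    assume nz: "P - Q \<noteq> 0"
    have "poly.coeff (P - Q) i = 0" if "i \<ge> n" for i
      using that P assms coeff_eq_0[of P i] by (cases "i = n") (auto simp: Q_def)
    then have "degree (P - Q) < n"
      using assms nz by (metis leading_coeff_0_iff not_less)
    moreover have "\<zeta> ` {..<n} \<subseteq> {x. poly (P - Q) x = 0}"
      by (auto simp: P_def Q_def poly_prod poly_monom pow intro!: bexI)
    then have "card (\<zeta> ` {..<n}) \<le> card {x. poly (P - Q) x = 0}"
      using nz by (intro card_mono poly_roots_finite)
    then have "n \<le> card {x. poly (P - Q) x = 0}"
      using inj by (simp add: card_image)
    ultimately show False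
      using card_poly_roots_bound[OF nz] by linarith
  qed
  then have "poly P (1 / X) = poly Q (1 / X)" by simp
  then have "X ^ n * (\<Prod>r<n. 1 / X - \<zeta> r) = X ^ n * ((1 / X) ^ n - 1)"
    by (simp add: P_def Q_def poly_prod poly_monom)
  moreover have "X ^ n * (\<Prod>r<n. 1 / X - \<zeta> r) = (\<Prod>r<n. X * (1 / X - \<zeta> r))"
    by (simp add: prod.distrib)
  ultimately show ?thesis
    using False by (simp add: \<zeta>_def algebra_simps power_divide)
qed (use assms in simp)

lemma qpoch_prod_roots_unity:
  assumes "norm q < 1" and "n > 0"
  shows "(\<Prod>r<n. qpoch (e2pi (of_nat r / of_nat n) * q) q) = qpoch (q ^ n) (q ^ n)"
proof -
  have "(\<Prod>r<n. qpoch (e2pi (of_nat r / of_nat n) * q) q) =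
      (\<Prod>k. \<Prod>r<n. 1 - e2pi (of_nat r / of_nat n) * q * q ^ k)"
    by (rule qpoch_prod[OF assms(1)])
  also have "\<dots> = (\<Prod>k. \<Prod>r<n. 1 - (q * q ^ k) * e2pi (of_nat r / of_nat n))"
    by (simp add: mult_ac)
  also have "\<dots> = qpoch (q ^ n) (q ^ n)"
    unfolding prod_one_minus_roots_unity[OF assms(2)] qpoch_def
    by (simp add: power_mult_distrib mult.commute flip: power_mult)
  finally show ?thesis .
qed

text \<open>Once the constant factor \<open>1 - e2pi y\<close> is split off, the remaining products
  are symmetric under changing the sign of \<open>y\<close>, which prepares the pairing of r with n
  - r.\<close>

lemma klein_0:
  assumes "Im z > 0"
  shows "klein 0 y z = e2pi (- (of_real y / 2)) * (1 - e2pi (of_real y)) *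
     (qpoch (e2pi (of_real y) * e2pi z) (e2pi z) * qpoch (e2pi (- of_real y) * e2pi z) (e2pi z)) /
     (qpoch (e2pi z) (e2pi z))\<^sup>2"
proof -
  have "e2pi (z - of_real y) = e2pi (- of_real y) * e2pi z"
    unfolding e2pi_add[symmetric] by simp
  then show ?thesis
    using qpoch_rec[OF norm_e2pi_less_1[OF assms], of "e2pi (of_real y)"]
    by (simp add: klein_def jtheta_def)
qed

text \<open>The numbers r and -r for 1 <= r <= h run through all nonzero residues modulo
  \<open>n\<close>. The products therefore range over the nontrivial roots of unity, and r = 0
  supplies the missing factor \<open>?P\<close>.\<close>

lemma prod_klein_eq_eta_quotient:
  assumes n: "n = 2 * h + 1"
  shows "\<exists>C. C \<noteq> 0 \<and> (\<forall>z. Im z > 0 \<longrightarrow>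
    (\<Prod>r=1..h. klein 0 (real r / real n) z) = C * (dedekind_eta (of_nat n * z) / dedekind_eta z ^ n))"
proof (intro exI conjI allI impI)
  let ?\<zeta> = "\<lambda>r::nat. e2pi (of_nat r / of_nat n)"
  define C where "C = (\<Prod>r=1..h. e2pi (- (of_real (real r / real n) / 2)) * (1
      - e2pi (of_real (real r / real n))))"
  have "e2pi (of_real (real r / real n)) \<noteq> 1" if "r \<in> {1..h}" for r
  proof
    assume "e2pi (of_real (real r / real n)) = 1"
    then have "complex_of_real (real r / real n) \<in> \<int>"
      by (simp add: e2pi_eq_1_iff)
    then obtain k :: int where "real r / real n = of_int k"
      by (metis Ints_cases of_real_eq_iff of_real_of_int_eq)
    then have "0 < real_of_int k" "real_of_int k < 1"
      using that n by (auto simp: field_simps simp flip: \<open>real r / real n = of_int k\<close>)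
    then have "0 < k" "k < 1" by simp_all
    then show False by simp
  qed
  then show "C \<noteq> 0" by (auto simp: C_def)
  fix z :: complex assume z: "Im z > 0"
  let ?q = "e2pi z" and ?P = "qpoch (e2pi z) (e2pi z)"
  note q = norm_e2pi_less_1[OF z]
  have P: "?P \<noteq> 0" using qpoch_nonzero[OF q q] .
  \<comment> \<open>The reflection to \<open>n - r\<close> inverts the root of unity, so the upper
    half of the residues yields the inverses of the lower half.\<close>
  have "(\<Prod>r\<in>{h+1..2*h}. qpoch (?\<zeta> r * ?q) ?q) =
      (\<Prod>r=1..h. qpoch (e2pi (- of_real (real r / real n)) * ?q) ?q)"
  proof (rule prod.reindex_bij_witness[of _ "\<lambda>r. n - r" "\<lambda>r. n - r"])
    fix r assume r: "r \<in> {h+1..2*h}"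
    have "- complex_of_real (real (n - r) / real n) = of_nat r / of_nat n + of_int (- 1)"
    proof -
      have "n \<noteq> 0" using n by simp
      then have "of_nat n \<noteq> (0 :: complex)" by simp
      moreover have "complex_of_real (real (n - r)) = of_nat n - of_nat r"
        using r n by (simp add: of_nat_diff)
      ultimately show ?thesis by (simp add: field_simps)
    qed
    then show "qpoch (e2pi (- of_real (real (n - r) / real n)) * ?q) ?q = qpoch (?\<zeta> r * ?q) ?q"
      by (simp only: e2pi_add_of_int)
  qed (use n in auto)
  moreover have "(\<Prod>r<n. qpoch (?\<zeta> r * ?q) ?q) =
      ?P * ((\<Prod>r=1..h. qpoch (?\<zeta> r * ?q) ?q) * (\<Prod>r\<in>{h+1..2*h}. qpoch (?\<zeta> r * ?q) ?q))"
  proof -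
    have "{..<n} = insert 0 ({1..h} \<union> {h+1..2*h})"
      using n by auto
    then show ?thesis by (simp add: prod.union_disjoint)
  qed
  ultimately have split: "qpoch (?q ^ n) (?q ^ n) =
      ?P * (\<Prod>r=1..h. qpoch (e2pi (of_real (real r / real n)) * ?q) ?q
          * qpoch (e2pi (- of_real (real r / real n)) * ?q) ?q)"
    using qpoch_prod_roots_unity[OF q, of n] n by (simp add: prod.distrib)
  have "(\<Prod>r=1..h. klein 0 (real r / real n) z) =
      C * (\<Prod>r=1..h. qpoch (e2pi (of_real (real r / real n)) * ?q) ?q
          * qpoch (e2pi (- of_real (real r / real n)) * ?q) ?q) / (?P\<^sup>2) ^ h"
    unfolding klein_0[OF z] C_def prod_dividef prod.distrib by simp
  also have "\<dots> = C * (qpoch (?q ^ n) (?q ^ n) / ?P ^ n)"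
    unfolding split using P by (simp add: n power_mult)
  \<comment> \<open>No power of q is left over, since the prefactor of the numerator is
    \<open>e2pi (z / 24) ^ n\<close>, the same as that of the denominator.\<close>
  also have "qpoch (?q ^ n) (?q ^ n) / ?P ^ n = dedekind_eta (of_nat n * z) / dedekind_eta z ^ n"
    using e2pi_of_nat_mult[of n "z / 24"]
    by (simp add: dedekind_eta_eq e2pi_of_nat_mult power_mult_distrib)
  finally show "(\<Prod>r=1..h. klein 0 (real r / real n) z) =
      C * (dedekind_eta (of_nat n * z) / dedekind_eta z ^ n)" .
qed

text \<open>The sign is moved into the exponential, so that the multiplier of a product of Klein
  forms is found by summing exponents.\<close>

lemma klein_shift_e2pi:
  fixes m n :: int
  assumes z: "Im z > 0"
  shows "klein (x + of_int m) (y + of_int n) z =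
    e2pi (of_real ((of_int (m * n + m + n) + x * of_int n - y * of_int m) / 2)) * klein x y z"
proof -
  have "complex_of_real ((of_int (m * n + m + n) + x * of_int n - y * of_int m) / 2) =
    of_int (m * n + m + n) / 2 + of_real (x * of_int n - y * of_int m) / 2"
    by (simp add: field_simps)
  then show ?thesis
    unfolding klein_shift[OF z] by (simp only: e2pi_add e2pi_half_of_int)
qed

section \<open>The product of Klein forms under Gamma_1(n)\<close>

lemma sum_upto_real: "(\<Sum>r=1..h. real r) = real h * (real h + 1) / 2"
  by (induction h) (auto simp: field_simps)

lemma sum_squares_real: "(\<Sum>r=1..h. real r * real r) = real h * (real h + 1) * (2 * real h + 1) / 6"
  by (induction h) (auto simp: field_simps)

(* The total root of unity is e(T d' (n c' + 3) / 2), and T d' (n c' + 3) is even: n is odd, and if c'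
   is even, then so is c, hence d is odd and d' is even. *)
lemma prod_klein_Gamma1:
  fixes a b c d c' d' :: int
  assumes z: "Im z > 0" and det: "a * d - b * c = 1" and n: "n = 2 * h + 1"
    and h: "h * (h + 1) = 6 * T" and c: "c = int n * c'" and d: "d = 1 + int n * d'"
  shows "(\<Prod>r=1..h. klein 0 (real r / real n) ((of_int a * z + of_int b) / (of_int c * z + of_int d))) =
    (\<Prod>r=1..h. klein 0 (real r / real n) z) / (of_int c * z + of_int d) ^ h"
proof -
  define m where "m r = (of_int (int r * c' * (int r * d') + int r * c' + int r * d') - real r / real n
      * of_int (int r * c')) / 2" for r
  have *: "klein 0 (real r / real n) ((of_int a * z + of_int b) / (of_int c * z + of_int d)) =
     e2pi (of_real (m r)) * klein 0 (real r / real n) z / (of_int c * z + of_int d)" for r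
  proof -
    \<comment> \<open>The row vector (0, r/n) goes to (rc/n, rd/n) = (rc', r/n + rd'). The
      congruences for \<open>c\<close> and \<open>d\<close> say exactly that this is an integer
      shift of (0, r/n).\<close>
    have "klein 0 (real r / real n) ((of_int a * z + of_int b) / (of_int c * z + of_int d)) =
       klein (0 + of_int (int r * c')) (real r / real n + of_int (int r * d')) z / (of_int c * z + of_int d)"
      unfolding klein_transform[OF z det] using n by (simp add: c d distrib_left)
    also have "\<dots> = e2pi (of_real (m r)) * klein 0 (real r / real n) z / (of_int c * z + of_int d)"
      unfolding klein_shift_e2pi[OF z] by (simp add: m_def)
    finally show ?thesis .
  qed
  have "even (int T * (int n * c' * d' + 2 * c' + 3 * d'))"
  proof (cases "even c'")
    case True
    then have "even c" by (simp add: c)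
    have "odd d"
    proof
      assume "even d"
      with \<open>even c\<close> have "even (a * d - b * c)" by simp
      then show False by (simp add: det)
    qed
    then have "even d'" using n by (simp add: d)
    then show ?thesis by simp
  qed (simp add: n)
  then obtain k where k: "int T * (int n * c' * d' + 2 * c' + 3 * d') = 2 * k" by blast
  have hT: "real h * (real h + 1) = 6 * real T"
    using arg_cong[OF h, of real] by (simp add: algebra_simps)
  have "(\<Sum>r=1..h. m r) = (\<Sum>r=1..h. real r * real r * ((of_int (c' * d') - of_int c' / real n)
      / 2) + real r * (of_int (c' + d') / 2))"
    by (rule sum.cong) (auto simp: m_def field_simps)
  also have "\<dots> = (\<Sum>r=1..h. real r * real r) * ((of_int (c' * d') - of_int c' / real n) / 2)
      + (\<Sum>r=1..h. real r) * (of_int (c' + d') / 2)"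
    by (simp only: sum.distrib sum_distrib_right)
  \<comment> \<open>From \<open>h * (h + 1) = 6 * T\<close>, the squares sum to \<open>T * n\<close>
    and the numbers themselves to \<open>3 * T\<close>.\<close>
  also have "\<dots> = real T * real n * ((of_int (c' * d') - of_int c' / real n) / 2) + 3 * real T
      * (of_int (c' + d') / 2)"
    unfolding sum_upto_real sum_squares_real hT using n by simp
  also have "\<dots> = of_int (int T * (int n * c' * d' + 2 * c' + 3 * d')) / 2"
    using n by (simp add: field_simps)
  also have "\<dots> = of_int k"
    unfolding k by simp
  finally have "complex_of_real (\<Sum>r=1..h. m r) = of_int k"
    by simp
  then have "(\<Prod>r=1..h. e2pi (of_real (m r))) = 1"
    unfolding e2pi_sum[symmetric] of_real_sum[symmetric] by simp
  then show ?thesis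
    unfolding * prod_dividef prod.distrib by simp
qed

text \<open>Up to powers of q and constants, the three products are squares of the Weber functions,
  whose product is constant by Euler's identity at the square root \<open>?h\<close> of q. The
  powers of q left over after the fourth power are those of eta^24.\<close>

lemma prod_klein_half_eta:
  "\<exists>C. C \<noteq> 0 \<and> (\<forall>z. Im z > 0 \<longrightarrow>
    (klein (1/2) 0 z * klein 0 (1/2) z * klein (1/2) (1/2) z) ^ 4 * dedekind_eta z ^ 24 = C)"
proof (intro exI conjI allI impI)
  \<comment> \<open>The 2 is \<open>1 - e2pi (1 / 2)\<close>; the other two factors are the constant
    parts of the prefactors at (0, 1/2) and (1/2, 1/2).\<close>
  define C where "C = (2 * e2pi (- (1 / 4)) * e2pi (- (1 / 8))) ^ 4"
  show "C \<noteq> 0" by (simp add: C_def)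
  fix z :: complex assume z: "Im z > 0"
  let ?q = "e2pi z" and ?P = "qpoch (e2pi z) (e2pi z)" and ?h = "e2pi (z / 2)"
  note q = norm_e2pi_less_1[OF z]
  have P: "?P \<noteq> 0" using qpoch_nonzero[OF q q] .
  have 1: "klein (1/2) 0 z = e2pi (- (z / 8)) * (qpoch ?h ?q)\<^sup>2 / ?P\<^sup>2"
  proof -
    have "klein (1/2) 0 z = (e2pi (z / 8) * e2pi (- (z / 4))) * (qpoch ?h ?q)\<^sup>2 / ?P\<^sup>2"
      by (simp add: klein_def jtheta_def power2_eq_square)
    then show ?thesis
      unfolding e2pi_add[symmetric] by simp
  qed
  have 2: "klein 0 (1/2) z = 2 * e2pi (- (1 / 4)) * (qpoch (- ?q) ?q)\<^sup>2 / ?P\<^sup>2"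
    unfolding klein_0[OF z] by (simp add: e2pi_minus power2_eq_square)
  have 3: "klein (1/2) (1/2) z = e2pi (- (1 / 8)) * e2pi (- (z / 8)) * (qpoch (- ?h) ?q)\<^sup>2 / ?P\<^sup>2"
  proof -
    have a: "e2pi (z / 2 + 1 / 2) = - ?h" "e2pi (z / 2 - 1 / 2) = - ?h"
      using e2pi_add[of "z / 2" "1 / 2"] e2pi_add[of "z / 2" "1 / 2 + of_int (-1)"] e2pi_add_of_int[of "1 / 2" "-1"]
      by (simp_all add: field_simps)
    have "klein (1/2) (1/2) z = (e2pi ((z / 2 + 1 / 2) / 4) * e2pi (- ((z / 2 + 1 / 2) / 2)))
        * (qpoch (- ?h) ?q)\<^sup>2 / ?P\<^sup>2"
      by (simp add: klein_def jtheta_def power2_eq_square a)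
    also have "e2pi ((z / 2 + 1 / 2) / 4) * e2pi (- ((z / 2 + 1 / 2) / 2)) = e2pi (- (1 / 8)) * e2pi (- (z / 8))"
      unfolding e2pi_add[symmetric] by (rule arg_cong[where f = e2pi]) (simp add: field_simps)
    finally show ?thesis .
  qed
  have "?h\<^sup>2 = ?q"
    using e2pi_of_nat_mult[of 2 "z / 2"] by simp
  then have Euler: "qpoch ?h ?q * qpoch (- ?h) ?q * qpoch (- ?q) ?q = 1"
    using qpoch_mult_minus[OF q, of ?h] qpoch_Euler[OF q] by simp
  have "klein (1/2) 0 z * klein 0 (1/2) z * klein (1/2) (1/2) z =
     2 * e2pi (- (1 / 4)) * e2pi (- (1 / 8)) * (e2pi (- (z / 8)))\<^sup>2 *
       (qpoch ?h ?q * qpoch (- ?h) ?q * qpoch (- ?q) ?q)\<^sup>2 / ?P ^ 6"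
    unfolding 1 2 3 by (simp add: power2_eq_square eval_nat_numeral mult_ac)
  then have "klein (1/2) 0 z * klein 0 (1/2) z * klein (1/2) (1/2) z =
     2 * e2pi (- (1 / 4)) * e2pi (- (1 / 8)) * (e2pi (- (z / 8)))\<^sup>2 / ?P ^ 6"
    unfolding Euler by simp
  moreover have "((e2pi (- (z / 8)))\<^sup>2) ^ 4 * e2pi (z / 24) ^ 24 = 1"
    by (simp flip: e2pi_of_nat_mult e2pi_add power_mult)
  ultimately show "(klein (1/2) 0 z * klein 0 (1/2) z * klein (1/2) (1/2) z) ^ 4 * dedekind_eta z ^ 24 = C"
    using P by (simp add: C_def dedekind_eta_eq power_mult_distrib power_divide flip: power_mult)
qed

text \<open>At a half-period the exponent of the multiplier is a multiple of 1/4. This is the reason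
  for taking fourth powers.\<close>

lemma klein_half_mod_2:
  assumes z: "Im z > 0"
  shows "klein (of_int m / 2) (of_int n / 2) z ^ 4 = klein (of_int (m mod 2) / 2) (of_int (n mod 2) / 2) z ^ 4"
proof -
  define m' n' where "m' = m div 2" and "n' = n div 2"
  define x y where "x = m mod 2" and "y = n mod 2"
  have m: "real_of_int m / 2 = of_int x / 2 + of_int m'"
    using mult_div_mod_eq[of 2 m] unfolding m'_def x_def by linarith
  have n: "real_of_int n / 2 = of_int y / 2 + of_int n'"
    using mult_div_mod_eq[of 2 n] unfolding n'_def y_def by linarith
  have "e2pi (of_real ((of_int (m' * n' + m' + n') + of_int x / 2 * of_int n' - of_int y / 2 * of_int m')
      / 2)) ^ 4 =
     e2pi (of_int (2 * (m' * n' + m' + n') + x * n' - y * m'))"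
    unfolding e2pi_of_nat_mult[symmetric] by (rule arg_cong[where f = e2pi]) (simp add: field_simps)
  then show ?thesis
    unfolding m n klein_shift_e2pi[OF z] power_mult_distrib x_def[symmetric] y_def[symmetric]
        by (simp only: e2pi_of_int mult_1)
qed

text \<open>Modulo 2 the matrix permutes the three nonzero vectors, so \<open>W\<close> is only
  reordered and picks up the factor j^-4 three times. The relation between \<open>W\<close> and
  eta^24 then turns weight -12 into weight 12.\<close>

lemma dedekind_eta_24_transform:
  fixes a b c d :: int
  assumes z: "Im z > 0" and det: "a * d - b * c = 1"
  shows "dedekind_eta ((of_int a * z + of_int b) / (of_int c * z + of_int d)) ^ 24 =
    (of_int c * z + of_int d) ^ 12 * dedekind_eta z ^ 24"
proof -
  define j where "j = of_int c * z + of_int d"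
  define \<tau> where "\<tau> = (of_int a * z + of_int b) / j"
  have j: "j \<noteq> 0"
    unfolding j_def using det by (intro cz_d_nonzero z) auto
  have \<tau>: "Im \<tau> > 0"
    using j z Im_moebius[OF det, of z] by (simp add: \<tau>_def j_def)
  define K where "K m n z = klein (of_int m / 2) (of_int n / 2) z ^ 4" for m n :: int and z
  define W where "W z = (klein (1/2) 0 z * klein 0 (1/2) z * klein (1/2) (1/2) z) ^ 4" for z
  have W: "W z = K 1 0 z * K 0 1 z * K 1 1 z" for z
    by (simp add: W_def K_def power_mult_distrib)
  have Kmod: "K m n z = K (m mod 2) (n mod 2) z" for m n
    unfolding K_def by (rule klein_half_mod_2[OF z])
  have tr: "K m n \<tau> = K (m * a + n * c) (m * b + n * d) z / j ^ 4" for m n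
    unfolding K_def \<tau>_def j_def klein_transform[OF z det] by (simp add: power_divide field_simps)
  have "K a b z * K c d z * K (a + c) (b + d) z = W z"
  proof -
    define a0 b0 c0 d0 where "a0 = a mod 2" and "b0 = b mod 2" and "c0 = c mod 2" and "d0 = d mod 2"
    note defs = a0_def b0_def c0_def d0_def
    have "odd (a * d - b * c)"
      by (simp add: det)
    then have "odd (a0 * d0 - b0 * c0)"
      by (simp add: defs)
    moreover have "a0 = 0 \<or> a0 = 1" "b0 = 0 \<or> b0 = 1" "c0 = 0 \<or> c0 = 1" "d0 = 0 \<or> d0 = 1"
      unfolding defs by auto
    moreover have "K a b z = K a0 b0 z" "K c d z = K c0 d0 z"
      "K (a + c) (b + d) z = K ((a0 + c0) mod 2) ((b0 + d0) mod 2) z"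
      unfolding defs Kmod[of a b] Kmod[of c d] Kmod[of "a + c" "b + d"] mod_add_eq by simp_all
    ultimately show ?thesis
      \<comment> \<open>Of the 16 residue matrices modulo 2, the odd determinant leaves the six
        invertible ones, each permuting the factors.\<close>
      unfolding W by (elim disjE) simp_all
  qed
  then have W\<tau>: "W \<tau> = W z / j ^ 12"
    unfolding W[of \<tau>] tr by (simp add: field_simps flip: power_add)
  obtain C where "C \<noteq> 0" and C: "\<And>z. Im z > 0 \<Longrightarrow> W z * dedekind_eta z ^ 24 = C"
    using prod_klein_half_eta unfolding W_def by blast
  have "W z * dedekind_eta \<tau> ^ 24 = W z * (j ^ 12 * dedekind_eta z ^ 24)"
    using C[OF z] C[OF \<tau>] j by (simp add: W\<tau> field_simps)
  moreover have "W z \<noteq> 0" using C[OF z] \<open>C \<noteq> 0\<close> by auto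
  ultimately show ?thesis
    by (simp add: \<tau>_def j_def)
qed

section \<open>Expansions at the cusps\<close>

(* The exponent s is real because single Klein forms have fractional order at the cusps. For the
   full eta-quotient, invariance under z |-> z + N forces s to be an integer. *)
definition has_cusp_expansion :: "nat \<Rightarrow> (complex \<Rightarrow> complex) \<Rightarrow> bool" where
  "has_cusp_expansion N h \<longleftrightarrow> (\<exists>s :: real. \<exists>H. H meromorphic_on {0} \<and>
     (\<forall>z. Im z > 0 \<longrightarrow> h z = e2pi (of_real s * z / of_nat N) * H (e2pi (z / of_nat N))))"

lemma has_cusp_expansion_cong:
  assumes "has_cusp_expansion N h" and "\<And>z. Im z > 0 \<Longrightarrow> h' z = h z"
  shows "has_cusp_expansion N h'"
  using assms unfolding has_cusp_expansion_def by (elim ex_forward conj_forward) auto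

lemma has_cusp_expansion_const: "has_cusp_expansion N (\<lambda>_. C)"
  unfolding has_cusp_expansion_def
  by (rule exI[of _ 0], rule exI[of _ "\<lambda>_. C"]) auto

lemma has_cusp_expansion_mult:
  assumes "has_cusp_expansion N f" and "has_cusp_expansion N g"
  shows "has_cusp_expansion N (\<lambda>z. f z * g z)"
proof -
  obtain s H where 1: "H meromorphic_on {0}"
    "\<And>z. Im z > 0 \<Longrightarrow> f z = e2pi (of_real s * z / of_nat N) * H (e2pi (z / of_nat N))"
    using assms(1) unfolding has_cusp_expansion_def by blast
  obtain t K where 2: "K meromorphic_on {0}"
    "\<And>z. Im z > 0 \<Longrightarrow> g z = e2pi (of_real t * z / of_nat N) * K (e2pi (z / of_nat N))"
    using assms(2) unfolding has_cusp_expansion_def by blast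
  have "(\<lambda>Q. H Q * K Q) meromorphic_on {0}"
    by (intro meromorphic_intros 1 2)
  moreover have "f z * g z = e2pi (of_real (s + t) * z / of_nat N) * (H (e2pi (z / of_nat N))
      * K (e2pi (z / of_nat N)))" if "Im z > 0" for z
    using that by (simp add: 1 2 e2pi_add distrib_right add_divide_distrib)
  ultimately show ?thesis
    unfolding has_cusp_expansion_def by blast
qed

lemma has_cusp_expansion_prod:
  assumes "\<And>i. i \<in> I \<Longrightarrow> has_cusp_expansion N (f i)"
  shows "has_cusp_expansion N (\<lambda>z. \<Prod>i\<in>I. f i z)"
  using assms by (induction I rule: infinite_finite_induct)
    (auto intro: has_cusp_expansion_const has_cusp_expansion_mult)

text \<open>Exponents in an eta-quotient may be negative, which is why expansions are asked to be
  meromorphic and not just analytic in the local parameter.\<close>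

lemma has_cusp_expansion_powi:
  assumes "has_cusp_expansion N f"
  shows "has_cusp_expansion N (\<lambda>z. f z powi n)"
proof -
  obtain s H where 1: "H meromorphic_on {0}"
    "\<And>z. Im z > 0 \<Longrightarrow> f z = e2pi (of_real s * z / of_nat N) * H (e2pi (z / of_nat N))"
    using assms(1) unfolding has_cusp_expansion_def by blast
  have "(\<lambda>Q. H Q powi n) meromorphic_on {0}"
    by (intro meromorphic_intros 1)
  moreover have "f z powi n = e2pi (of_real (of_int n * s) * z / of_nat N) * (H (e2pi (z
      / of_nat N)) powi n)" if "Im z > 0" for z
    using that by (simp add: 1 power_int_mult_distrib e2pi_powi mult_ac)
  ultimately show ?thesis
    unfolding has_cusp_expansion_def by blast
qed

lemma qpoch_meromorphic_0:
  assumes "N > 0"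
  shows "(\<lambda>Q. qpoch (C * Q ^ m) (Q ^ N)) meromorphic_on {0}"
proof -
  have "(\<lambda>Q. qpoch (C * Q ^ m) (Q ^ N)) holomorphic_on ball 0 1"
    using assms by (intro holomorphic_on_qpoch holomorphic_intros)
      (auto simp: norm_power power_less_one_iff)
  then have "(\<lambda>Q. qpoch (C * Q ^ m) (Q ^ N)) analytic_on {0}"
    by (meson analytic_at centre_in_ball open_ball zero_less_one)
  then show ?thesis by (rule analytic_on_imp_meromorphic_on)
qed

lemma has_cusp_expansion_klein:
  assumes N: "N > 0"
  shows "has_cusp_expansion N (klein (of_int j / real N) y)"
proof -
  \<comment> \<open>The first coordinate is reduced to \<open>l / N\<close> in [0,1), so that both
    products, with arguments involving \<open>Q ^ l\<close> and \<open>Q ^ (N - l)\<close>, are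
    analytic in the local parameter Q = e(z/N). The integer part \<open>m\<close> costs only a
    constant.\<close>
  define m where "m = j div int N"
  define l where "l = nat (j mod int N)"
  have l: "int l = j mod int N" "l < N"
    using N by (auto simp: l_def nat_less_iff)
  have "real_of_int j = real N * of_int m + real l"
    using mult_div_mod_eq[of "int N" j] unfolding m_def l(1)[symmetric]
    by (metis of_int_add of_int_mult of_int_of_nat_eq)
  then have j: "of_int j / real N = real l / real N + of_int m"
    using N by (simp add: field_simps)
  define x where "x = real l / real N"
  have "has_cusp_expansion N (klein x y)"
    unfolding has_cusp_expansion_def
  proof (intro exI conjI allI impI)
    define H where "H = (\<lambda>Q. e2pi (of_real ((x - 1) / 2 * y)) * qpoch (e2pi (of_real y) * Q ^ l) (Q ^ N) *
      qpoch (e2pi (- of_real y) * Q ^ (N - l)) (Q ^ N) / (qpoch (1 * Q ^ N) (Q ^ N))\<^sup>2)"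
    show "H meromorphic_on {0}"
      unfolding H_def by (intro meromorphic_intros qpoch_meromorphic_0 N)
    fix z :: complex assume z: "Im z > 0"
    let ?Q = "e2pi (z / of_nat N)"
    have QN: "?Q ^ N = e2pi z"
      using N by (simp flip: e2pi_of_nat_mult)
    have Q1: "e2pi (of_real y) * ?Q ^ l = e2pi (of_real x * z + of_real y)"
      by (simp add: x_def add_ac flip: e2pi_of_nat_mult e2pi_add)
    have Q2: "e2pi (- of_real y) * ?Q ^ (N - l) = e2pi (z - (of_real x * z + of_real y))"
      unfolding e2pi_of_nat_mult[symmetric] e2pi_add[symmetric]
      by (rule arg_cong[where f = e2pi]) (use l N in \<open>simp add: x_def of_nat_diff field_simps\<close>)
    have "e2pi (of_real x * (of_real x * z + of_real y) / 2) * e2pi (- ((of_real x * z + of_real y) / 2)) =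
       e2pi (of_real ((x - 1) / 2 * x * real N) * z / of_nat N) * e2pi (of_real ((x - 1) / 2 * y))"
      unfolding e2pi_add[symmetric]
      by (rule arg_cong[where f = e2pi]) (use N in \<open>simp add: field_simps\<close>)
    then show "klein x y z = e2pi (of_real ((x - 1) / 2 * x * real N) * z / of_nat N) * H ?Q"
      unfolding klein_def jtheta_def H_def Q1 Q2 QN by simp
  qed
  then have "has_cusp_expansion N (\<lambda>z. e2pi (of_real ((of_int m - y * of_int m) / 2)) * klein x y z)"
    by (intro has_cusp_expansion_mult has_cusp_expansion_const)
  then show ?thesis
    by (rule has_cusp_expansion_cong)
      (use klein_shift_e2pi[of _ x m y 0] in \<open>simp add: j x_def\<close>)
qed

lemma has_cusp_expansion_eta_24:
  assumes N: "N > 0"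
  shows "has_cusp_expansion N (\<lambda>z. dedekind_eta z ^ 24)"
  unfolding has_cusp_expansion_def
proof (intro exI conjI allI impI)
  show "(\<lambda>Q. qpoch (1 * Q ^ N) (Q ^ N) ^ 24) meromorphic_on {0}"
    by (intro meromorphic_intros qpoch_meromorphic_0 N)
  fix z :: complex assume z: "Im z > 0"
  have "e2pi (z / of_nat N) ^ N = e2pi z" "e2pi (z / 24) ^ 24 = e2pi z"
    using N by (simp_all flip: e2pi_of_nat_mult)
  then show "dedekind_eta z ^ 24 = e2pi (of_real (real N) * z / of_nat N) *
      qpoch (1 * e2pi (z / of_nat N) ^ N) (e2pi (z / of_nat N) ^ N) ^ 24"
    using N by (simp add: dedekind_eta_eq power_mult_distrib)
qed

text \<open>\<open>H\<close> is evaluated at a function of period \<open>N\<close>, so translation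
  by \<open>N\<close> multiplies \<open>h\<close> by \<open>e2pi s\<close>; a single nonzero value
  then forces this to be 1.\<close>

lemma has_cusp_expansion_periodic:
  assumes "has_cusp_expansion N h" and N: "N > 0"
    and per: "\<And>z. Im z > 0 \<Longrightarrow> h (z + of_nat N) = h z"
    and nz: "Im z0 > 0" "h z0 \<noteq> 0"
  shows "\<exists>g. g meromorphic_on {0} \<and>
    (\<forall>z \<in> upper_half_plane. h z = g (exp (2 * of_real pi * \<i> * z / of_nat N)))"
proof -
  obtain s H where H: "H meromorphic_on {0}"
    "\<And>z. Im z > 0 \<Longrightarrow> h z = e2pi (of_real s * z / of_nat N) * H (e2pi (z / of_nat N))"
    using assms(1) unfolding has_cusp_expansion_def by blast
  have "of_real s * (z0 + of_nat N) / of_nat N = of_real s * z0 / of_nat N + of_real s"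
    "(z0 + of_nat N) / of_nat N = z0 / of_nat N + 1"
    using N by (simp_all add: field_simps)
  then have "h (z0 + of_nat N) = e2pi (of_real s) * h z0"
    using nz by (simp add: H e2pi_add)
  then have "e2pi (of_real s) = 1"
    using per[OF nz(1)] nz(2) by simp
  then have "complex_of_real s \<in> \<int>"
    by (simp add: e2pi_eq_1_iff)
  then obtain k where k: "complex_of_real s = of_int k"
    by (auto elim: Ints_cases)
  show ?thesis
  proof (intro exI conjI ballI)
    show "(\<lambda>Q. Q powi k * H Q) meromorphic_on {0}"
      by (intro meromorphic_intros H)
    fix z assume "z \<in> upper_half_plane"
    then have "h z = e2pi (z / of_nat N) powi k * H (e2pi (z / of_nat N))"
      by (simp add: upper_half_plane_def H k e2pi_powi)
    then show "h z = exp (2 * of_real pi * \<i> * z / of_nat N) powi k * H (exp (2 * of_real pi * \<i>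
        * z / of_nat N))"
      by (simp add: e2pi_def)
  qed
qed

text \<open>For n = 2h+1 its weight is (1-n)/2 = -h. The power in the denominator makes the leading
  powers of q cancel at infinity.\<close>

definition eta_ratio :: "nat \<Rightarrow> complex \<Rightarrow> complex" where
  "eta_ratio n z = dedekind_eta (of_nat n * z) / dedekind_eta z ^ n"

lemma eta_ratio_nonzero: "Im z > 0 \<Longrightarrow> n > 0 \<Longrightarrow> eta_ratio n z \<noteq> 0"
  by (simp add: eta_ratio_def dedekind_eta_nonzero)

lemma moebius_Im_pos:
  fixes a b c d :: int
  assumes "a * d - b * c = 1" and "Im z > 0"
  shows "Im ((of_int a * z + of_int b) / (of_int c * z + of_int d)) > 0"
proof -
  have "of_int c * z + of_int d \<noteq> 0"
    using assms by (intro cz_d_nonzero) auto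
  then show ?thesis
    using assms by (simp add: Im_moebius)
qed

lemma eta_ratio_Gamma1:
  fixes a b c d c' d' :: int
  assumes z: "Im z > 0" and det: "a * d - b * c = 1" and n: "n = 2 * h + 1"
    and h: "h * (h + 1) = 6 * T" and c: "c = int n * c'" and d: "d = 1 + int n * d'"
  shows "(of_int c * z + of_int d) ^ h *
    eta_ratio n ((of_int a * z + of_int b) / (of_int c * z + of_int d)) = eta_ratio n z"
proof -
  obtain C where C: "C \<noteq> 0"
    "\<And>z. Im z > 0 \<Longrightarrow> (\<Prod>r=1..h. klein 0 (real r / real n) z) = C * eta_ratio n z"
    using prod_klein_eq_eta_quotient[OF n] unfolding eta_ratio_def by blast
  have j: "of_int c * z + of_int d \<noteq> 0"
    using det by (intro cz_d_nonzero z) auto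
  then show ?thesis
    using prod_klein_Gamma1[OF z det n h c d] C(1) unfolding C(2)[OF z] C(2)[OF moebius_Im_pos[OF det z]]
    by (simp add: field_simps)
qed

lemma eta_ratio_has_cusp_expansion:
  fixes a b c d :: int
  assumes det: "a * d - b * c = 1" and n: "n = 2 * h + 1" and N: "N > 0" "n dvd N"
  shows "has_cusp_expansion N (\<lambda>z. (of_int c * z + of_int d) ^ h *
    eta_ratio n ((of_int a * z + of_int b) / (of_int c * z + of_int d)))"
proof -
  obtain C where C: "C \<noteq> 0"
    "\<And>z. Im z > 0 \<Longrightarrow> (\<Prod>r=1..h. klein 0 (real r / real n) z) = C * eta_ratio n z"
    using prod_klein_eq_eta_quotient[OF n] unfolding eta_ratio_def by blast
  obtain M where M: "N = n * M" using N by blast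
  \<comment> \<open>The matrix moves (0, r/n) to (rc/n, rd/n). Writing rc/n as rMc/N puts the first
    coordinate over the denominator \<open>N\<close> demanded by the expansion of a Klein
    form.\<close>
  have "has_cusp_expansion N (\<lambda>z. inverse C * (\<Prod>r=1..h. klein (of_int (int (r * M) * c)
      / real N) (real r / real n * of_int d) z))"
    by (intro has_cusp_expansion_mult has_cusp_expansion_const has_cusp_expansion_prod has_cusp_expansion_klein N)
  then show ?thesis
  proof (rule has_cusp_expansion_cong)
    fix z :: complex assume z: "Im z > 0"
    let ?j = "of_int c * z + of_int d" and ?\<tau> = "(of_int a * z + of_int b) / (of_int c * z + of_int d)"
    have j: "?j \<noteq> 0"
      using det by (intro cz_d_nonzero z) auto
    have "klein 0 (real r / real n) ?\<tau> =
        klein (of_int (int (r * M) * c) / real N) (real r / real n * of_int d) z / ?j" for r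
      unfolding klein_transform[OF z det] using N M by simp
    then have "C * eta_ratio n ?\<tau> =
        (\<Prod>r=1..h. klein (of_int (int (r * M) * c) / real N) (real r / real n * of_int d) z) / ?j ^ h"
      unfolding C(2)[OF moebius_Im_pos[OF det z], symmetric] by (simp add: prod_dividef)
    then show "?j ^ h * eta_ratio n ?\<tau> =
        inverse C * (\<Prod>r=1..h. klein (of_int (int (r * M) * c) / real N) (real r / real n * of_int d) z)"
      using C(1) j by (simp add: field_simps)
  qed
qed

section \<open>Translation by \<open>N\<close> at an arbitrary cusp\<close>

lemma SL2Z_det: "A \<in> SL2Z \<longleftrightarrow> A $ 1 $ 1 * A $ 2 $ 2 - A $ 1 $ 2 * A $ 2 $ 1 = 1"
  by (simp add: SL2Z_def det_2)

text \<open>With T the translation by \<open>N\<close>, the matrix \<open>B\<close> is A T A^-1. It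
  is congruent to the identity modulo \<open>N\<close>, so invariance under \<open>B\<close> at A z
  is invariance of the slashed function under T.\<close>

lemma slash_cusp_periodic:
  assumes inv: "\<And>B w. B \<in> Gamma1 N \<Longrightarrow> Im w > 0 \<Longrightarrow> slash k f B w = f w"
    and A: "A \<in> SL2Z" and z: "Im z > 0"
  shows "slash k f A (z + of_nat N) = slash k f A z"
proof -
  define a b c d where "a = A $ 1 $ 1" and "b = A $ 1 $ 2" and "c = A $ 2 $ 1" and "d = A $ 2 $ 2"
  note defs = a_def b_def c_def d_def
  have det: "a * d - b * c = 1"
    using A by (simp add: SL2Z_det defs)
  have det': "of_int a * of_int d = (1 + of_int b * of_int c :: complex)"
    using det by (metis add.commute diff_add_cancel of_int_1 of_int_add of_int_mult)
  define j j' where "j = of_int c * z + of_int d" and "j' = of_int c * (z + of_nat N) + of_int d"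
  have j: "j \<noteq> 0" and j': "j' \<noteq> 0"
    unfolding j_def j'_def using det by (intro cz_d_nonzero; use z in auto)+
  define B :: "int^2^2" where "B =
      vector [vector [1 - a * c * int N, a\<^sup>2 * int N], vector [- (c\<^sup>2 * int N), 1 + a * c * int N]]"
  have B: "B \<in> Gamma1 N"
    unfolding Gamma1_def SL2Z_det mem_Collect_eq
    by (auto simp: B_def cong_iff_dvd_diff SL2Z_det algebra_simps power2_eq_square)
  define w where "w = (of_int a * z + of_int b) / j"
  have w: "Im w > 0"
    unfolding w_def j_def by (rule moebius_Im_pos[OF det z])
  have jw: "j * w = of_int a * z + of_int b"
    using j by (simp add: w_def)
  \<comment> \<open>The cocycle relation for B A = A T: the factor of \<open>B\<close> at w = A z is
    the quotient of the factors of \<open>A\<close> at z + N and at z.\<close>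
  have "j * (of_int (B $ 2 $ 1) * w + of_int (B $ 2 $ 2)) =
      - (of_int c)\<^sup>2 * of_nat N * (j * w) + (1 + of_int a * of_int c * of_nat N) * j"
    by (simp add: B_def algebra_simps)
  also have "\<dots> = j + of_int c * of_nat N * (of_int a * of_int d - of_int b * of_int c)"
    unfolding jw by (simp add: j_def algebra_simps power2_eq_square)
  also have "\<dots> = j'"
    unfolding det' by (simp add: j_def j'_def algebra_simps)
  finally have den: "of_int (B $ 2 $ 1) * w + of_int (B $ 2 $ 2) = j' / j"
    using j by (simp add: field_simps)
  have "j * (of_int (B $ 1 $ 1) * w + of_int (B $ 1 $ 2)) =
      (1 - of_int a * of_int c * of_nat N) * (j * w) + (of_int a)\<^sup>2 * of_nat N * j"
    by (simp add: B_def algebra_simps)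
  also have "\<dots> = of_int a * z + of_int b + of_int a * of_nat N * (of_int a * of_int d - of_int b * of_int c)"
    unfolding jw by (simp add: j_def algebra_simps power2_eq_square)
  also have "\<dots> = of_int a * (z + of_nat N) + of_int b"
    unfolding det' by (simp add: algebra_simps)
  finally have num: "of_int (B $ 1 $ 1) * w + of_int (B $ 1 $ 2) = (of_int a * (z + of_nat N) + of_int b) / j"
    using j by (simp add: field_simps)
  have mB: "moebius B w = moebius A (z + of_nat N)"
    unfolding moebius_def num den unfolding defs[symmetric] j'_def[symmetric] using j by simp
  have mA: "moebius A z = w"
    by (simp add: moebius_def w_def j_def defs)
  have "slash k f A z = j powi (- k) * slash k f B w"
    unfolding inv[OF B w] by (simp add: slash_def mA j_def defs)
  also have "\<dots> = (j * (j' / j)) powi (- k) * f (moebius A (z + of_nat N))"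
    unfolding slash_def den mB power_int_mult_distrib by simp
  also have "\<dots> = slash k f A (z + of_nat N)"
    using j by (simp add: slash_def j'_def defs)
  finally show ?thesis ..
qed

section \<open>The eta-quotient of level \<open>p * q\<close>\<close>

lemma dvd_prime_mult_prime:
  fixes p q :: nat
  assumes "prime p" "prime q"
  shows "{\<delta>. \<delta> dvd p * q} = {1, p, q, p * q}"
proof (intro equalityI subsetI)
  fix \<delta> assume "\<delta> \<in> {\<delta>. \<delta> dvd p * q}"
  then obtain a b where "\<delta> = a * b" "a dvd p" "b dvd q"
    using division_decomp by blast
  moreover have "a = 1 \<or> a = p" "b = 1 \<or> b = q"
    using calculation assms by (auto simp: prime_nat_iff)
  ultimately show "\<delta> \<in> {1, p, q, p * q}" by auto
qed auto

text \<open>The exponent at 1 collects the denominators of both ratios together with the power of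
  eta^24.\<close>

lemma eta_quotient_two_primes:
  assumes "prime p" "prime q" "p \<noteq> q" and z: "Im z > 0"
  shows "eta_quotient (p * q) (\<lambda>\<delta>. if \<delta> = 1 then 24 * m - int p * x - int q * y
      else if \<delta> = p then x else if \<delta> = q then y else 0) z =
    eta_ratio p z powi x * eta_ratio q z powi y * (dedekind_eta z ^ 24) powi m"
proof -
  have ne: "p \<noteq> 1" "q \<noteq> 1" "p * q \<noteq> p" "p * q \<noteq> q" "p * q \<noteq> 1"
    using assms prime_gt_1_nat[of p] prime_gt_1_nat[of q] by auto
  have nz: "dedekind_eta z \<noteq> 0"
    using dedekind_eta_nonzero[OF z] .
  have "dedekind_eta z powi (24 * m - int p * x - int q * y) =
     (dedekind_eta z ^ 24) powi m / (dedekind_eta z ^ p) powi x / (dedekind_eta z ^ q) powi y"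
    using nz by (simp add: power_int_diff power_int_power)
  then show ?thesis
    unfolding eta_quotient_def dvd_prime_mult_prime[OF assms(1,2)]
    using ne assms(3) ne[symmetric]
    by (simp add: eta_ratio_def power_int_divide_distrib)
qed

text \<open>If \<open>h\<close> were 1 modulo 3, then 3 would divide 2h+1 = p. Otherwise 3 divides
  \<open>h\<close> or \<open>h + 1\<close>, and a product of consecutive numbers is even.\<close>

lemma prime_half_product_dvd:
  assumes "prime p" "p > 3"
  obtains h T :: nat where "p = 2 * h + 1" "h * (h + 1) = 6 * T" "(p - 1) div 2 = h"
proof -
  have "odd p" using assms prime_odd_nat by auto
  then obtain h where h: "p = 2 * h + 1" by (auto elim: oddE)
  have "\<not> 3 dvd p"
    using assms primes_dvd_imp_eq[of 3 p] by auto
  then have "h mod 3 = 0 \<or> h mod 3 = 2"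
    unfolding h by presburger
  then have "3 dvd h \<or> 3 dvd h + 1" by presburger
  then have "3 dvd h * (h + 1)"
    by (meson dvd_mult dvd_mult2)
  moreover have "2 dvd h * (h + 1)" by simp
  ultimately have "3 * 2 dvd h * (h + 1)"
    by (intro divides_mult) auto
  then obtain T where "h * (h + 1) = 6 * T" by auto
  with h that show ?thesis by simp
qed

theorem theorem5p8:
  fixes p q N k :: nat
  assumes "prime p" and "prime q" and "p \<noteq> q" and "p > 3" and "q > 3"
    and "N = p * q"
    and "k > 0"
    and "Gcd {(p - 1) div 2, (q - 1) div 2, (p * q - 1) div 2, 12} dvd k"
  shows "\<exists>r :: nat \<Rightarrow> int. eta_quotient N r \<in> weakly_modular_Gamma1 N (int k)"
proof -
  obtain h T where h: "p = 2 * h + 1" "h * (h + 1) = 6 * T" "(p - 1) div 2 = h"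
    using prime_half_product_dvd[OF assms(1,4)] .
  obtain h' T' where h': "q = 2 * h' + 1" "h' * (h' + 1) = 6 * T'" "(q - 1) div 2 = h'"
    using prime_half_product_dvd[OF assms(2,5)] .
  have "(p * q - 1) div 2 = 2 * h * h' + h + h'"
    by (simp add: h(1) h'(1) algebra_simps)
  moreover have "gcd h (gcd h' 12) dvd h" "gcd h (gcd h' 12) dvd h'" "gcd h (gcd h' 12) dvd 12"
    by (auto intro: dvd_trans[OF gcd_dvd2])
  ultimately have "gcd h (gcd h' 12) dvd Gcd {(p - 1) div 2, (q - 1) div 2, (p * q - 1) div 2, 12}"
    unfolding h(3) h'(3)
    by (intro Gcd_greatest) (auto intro!: dvd_add dvd_mult simp del: gcd_greatest_iff)
  then have "int (gcd h (gcd h' 12)) dvd int k"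
    using assms(8) by (meson dvd_trans int_dvd_int_iff)
  then obtain t where t: "int k = int (gcd h (gcd h' 12)) * t" by blast
  obtain u v where uv: "u * int h + v * int (gcd h' 12) = int (gcd h (gcd h' 12))"
    using bezout_int[of "int h" "int (gcd h' 12)"] by auto
  obtain u' v' where uv': "u' * int h' + v' * 12 = int (gcd h' 12)"
    using bezout_int[of "int h'" 12] by (auto simp flip: gcd_int_int_eq)
  \<comment> \<open>The two Bezout relations are nested and scaled by \<open>t\<close>. The minus
    signs occur because the ratios have the negative weights -h and -h', whereas eta^24 has weight
    12.\<close>
  define x y m where "x = - (t * u)" and "y = - (t * v * u')" and "m = t * v * v'"
  have k: "int k = 12 * m - int h * x - int h' * y"
    unfolding t uv[symmetric] uv'[symmetric] by (simp add: x_def y_def m_def algebra_simps)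
  define r where "r = (\<lambda>\<delta>. if \<delta> = 1 then 24 * m - int p * x - int q * y
      else if \<delta> = p then x else if \<delta> = q then y else 0)"
  define f where "f = eta_quotient N r"
  have pos: "p > 0" "q > 0" "N > 0" using assms by auto
  have f: "f z = eta_ratio p z powi x * eta_ratio q z powi y * (dedekind_eta z ^ 24) powi m" if "Im z > 0" for z
    unfolding f_def r_def assms(6) by (rule eta_quotient_two_primes[OF assms(1-3) that])
  have f_nz: "f z \<noteq> 0" if "Im z > 0" for z
    using that pos by (simp add: f eta_ratio_nonzero dedekind_eta_nonzero)
  \<comment> \<open>The automorphy factor is distributed so that each building block receives its
    own weight; only eta^24 is modular on all of SL2(Z) and loses its factor at once. Invariance and
    the cusp expansions are both read off from this formula.\<close>
  have slash: "slash (int k) f A z =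
     ((of_int c * z + of_int d) ^ h * eta_ratio p ((of_int a * z + of_int b) / (of_int c * z + of_int d))) powi x *
     ((of_int c * z + of_int d) ^ h' * eta_ratio q ((of_int a * z + of_int b) / (of_int c * z + of_int d))) powi y *
     (dedekind_eta z ^ 24) powi m"
    if z: "Im z > 0" and A: "a = A $ 1 $ 1" "b = A $ 1 $ 2" "c = A $ 2 $ 1" "d = A $ 2 $ 2"
      "A \<in> SL2Z" for A :: "int ^ 2 ^ 2" and a b c d :: int and z :: complex
  proof -
    have det: "a * d - b * c = 1"
      using A by (simp add: SL2Z_det)
    define j where "j = of_int c * z + of_int d"
    define \<tau> where "\<tau> = (of_int a * z + of_int b) / j"
    have j: "j \<noteq> 0"
      unfolding j_def using det by (intro cz_d_nonzero z) auto
    have e: "- int k = int h * x + int h' * y + int 12 * (- m)"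
      by (simp add: k)
    have "j powi (- int k) = (j ^ h) powi x * (j ^ h') powi y * (j ^ 12) powi (- m)"
      using j by (simp only: e power_int_power power_int_add of_nat_numeral simp_thms)
    moreover have "(j ^ 12) powi (- m) * (j ^ 12) powi m = 1"
      using j by (simp add: power_int_minus)
    moreover have "dedekind_eta \<tau> ^ 24 = j ^ 12 * dedekind_eta z ^ 24"
      unfolding \<tau>_def j_def by (rule dedekind_eta_24_transform[OF z det])
    moreover have "f \<tau> = eta_ratio p \<tau> powi x * eta_ratio q \<tau> powi y
        * (dedekind_eta \<tau> ^ 24) powi m"
      unfolding \<tau>_def j_def by (rule f[OF moebius_Im_pos[OF det z]])
    ultimately have "j powi (- int k) * f \<tau> =
        (j ^ h * eta_ratio p \<tau>) powi x * (j ^ h' * eta_ratio q \<tau>) powi y *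
        (dedekind_eta z ^ 24) powi m"
      by (simp add: power_int_mult_distrib mult_ac)
    then show ?thesis
      by (simp add: slash_def moebius_def A(1-4) \<tau>_def j_def)
  qed
  have inv: "slash (int k) f A z = f z" if A: "A \<in> Gamma1 N" and z: "Im z > 0" for A z
  proof -
    define a b c d where "a = A $ 1 $ 1" and "b = A $ 1 $ 2" and "c = A $ 2 $ 1" and "d = A $ 2 $ 2"
    have SL: "A \<in> SL2Z" using A by (simp add: Gamma1_def)
    have det: "a * d - b * c = 1"
      using SL by (simp add: SL2Z_det a_def b_def c_def d_def)
    have "int N dvd c" "int N dvd d - 1"
      using A by (auto simp: Gamma1_def c_def d_def cong_iff_dvd_diff)
    then obtain c' d' where "c = int N * c'" "d - 1 = int N * d'" by blast
    \<comment> \<open>Gamma_1(pq) lies in both Gamma_1(p) and Gamma_1(q), so each ratio can be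
      treated at its own prime.\<close>
    then have c: "c = int p * (int q * c')" "c = int q * (int p * c')"
      and d: "d = 1 + int p * (int q * d')" "d = 1 + int q * (int p * d')"
      by (auto simp: assms(6) algebra_simps)
    show ?thesis
      unfolding slash[OF z a_def b_def c_def d_def SL] f[OF z]
        eta_ratio_Gamma1[OF z det h(1,2) c(1) d(1)] eta_ratio_Gamma1[OF z det h'(1,2) c(2) d(2)] ..
  qed
  have "f holomorphic_on upper_half_plane"
  proof -
    have op: "open upper_half_plane"
      unfolding upper_half_plane_def by (rule open_halfspace_Im_gt)
    have "(\<lambda>z. eta_ratio p z powi x * eta_ratio q z powi y
        * (dedekind_eta z ^ 24) powi m) holomorphic_on upper_half_plane"
      unfolding eta_ratio_def
      by (intro holomorphic_intros holomorphic_on_dedekind_eta op)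
        (use pos in \<open>auto simp: upper_half_plane_def dedekind_eta_nonzero\<close>)
    then show ?thesis
      by (rule holomorphic_transform) (simp add: f upper_half_plane_def)
  qed
  moreover have "meromorphic_at_cusps N (int k) f"
    unfolding meromorphic_at_cusps_def
  proof
    fix A assume A: "A \<in> SL2Z"
    define a b c d where "a = A $ 1 $ 1" and "b = A $ 1 $ 2" and "c = A $ 2 $ 1" and "d = A $ 2 $ 2"
    note defs = a_def b_def c_def d_def
    have det: "a * d - b * c = 1"
      using A by (simp add: SL2Z_det defs)
    have "p dvd N" "q dvd N" by (auto simp: assms(6))
    then have "has_cusp_expansion N (slash (int k) f A)"
      by (intro has_cusp_expansion_cong[OF _ slash[OF _ defs A]] has_cusp_expansion_mult has_cusp_expansion_powi
        eta_ratio_has_cusp_expansion[OF det h(1) pos(3)] eta_ratio_has_cusp_expansion[OF det h'(1) pos(3)]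
        has_cusp_expansion_eta_24 pos)
    moreover have "slash (int k) f A (z + of_nat N) = slash (int k) f A z" if "Im z > 0" for z
      by (rule slash_cusp_periodic[OF inv A that])
    \<comment> \<open>Eta has no zeros in the upper half plane, so any point can serve as the
      required nonzero value.\<close>
    moreover have "slash (int k) f A \<i> \<noteq> 0"
    proof -
      have "of_int c * \<i> + of_int d \<noteq> 0"
        using det by (intro cz_d_nonzero) auto
      moreover have "f (moebius A \<i>) \<noteq> 0"
        unfolding moebius_def defs[symmetric] by (rule f_nz[OF moebius_Im_pos[OF det]]) simp
      ultimately show ?thesis
        by (simp add: slash_def defs)
    qed
    ultimately show "\<exists>g. g meromorphic_on {0} \<and>
      (\<forall>z \<in> upper_half_plane. slash (int k) f A z = g (exp (2 * of_real pi * \<i> * z / of_nat N)))"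
      by (intro has_cusp_expansion_periodic[of N _ \<i>] pos) auto
  qed
  ultimately have "f \<in> weakly_modular_Gamma1 N (int k)"
    using inv by (simp add: weakly_modular_Gamma1_def upper_half_plane_def)
  then show ?thesis
    unfolding f_def by blast
qed

end
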